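(* Let $(M,g)$ be a Riemannian manifold of dimension $n>1$ with constant sectional curvature $c$, let $A>0$, and let $\lambda,\mu:(0,\infty)\to\mathbf{R}$ be smooth functions satisfying $$\lambda>0,\qquad \frac{2c-A^2t\lambda^2}{\lambda+2t\lambda'}>0,\qquad \lambda+2t\mu>0\qquad\text{for all } t>0 .$$ Let $(G,J)$ be the Hermitian structure on $T^*_0M$ given by $$J\frac{\delta}{\delta q^i}=J^{(1)}_{ij}\frac{\partial}{\partial p_j},\qquad J\frac{\partial}{\partial p_i}=-J_{(2)}^{ij}\frac{\delta}{\delta q^j},$$ $$J^{(1)}_{ij}=At\lambda\, g_{ij}+\frac{c-A^2t\lambda(\lambda+t\lambda')}{At(\lambda+2t\lambda')}\,p_ip_j,\qquad J_{(2)}^{ij}=\frac{1}{At\lambda}\,g^{ij}-\frac{c-A^2t\lambda(\lambda+t\lambda')}{At^2\lambda(2c-A^2t\lambda^2)}\,g^{0i}g^{0j},$$ and $G=(c_1g_{ij}+d_1p_ip_j)dq^idq^j+(c_2g^{ij}+d_2g^{0i}g^{0j})Dp_iDp_j$, where $$c_1=At\lambda^2,\qquad c_2=\frac{1}{At},\qquad d_1=\frac{\lambda[c-A^2t\lambda(\lambda+t\lambda')]+\mu t(2c-A^2t\lambda^2)}{At(\lambda+2t\lambda')},$$ $$d_2=\frac{-c+A^2t\lambda(\lambda+t\lambda')+\mu A^2t^2(\lambda+2t\lambda')}{At^2(2c-A^2t\lambda^2)}.$$ Then $(G,J)$ is K\"ahler if and only if $\mu=\lambda'$.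
   Context: Everything is smooth; repeated indices are summed over $1,\dots,n$. $(M,g)$ is a smooth $n$-dimensional Riemannian manifold, $\pi:T^*M\to M$ its cotangent bundle, $T^*_0M$ is $T^*M$ minus the zero section. A chart $(U,x^1,\dots,x^n)$ of $M$ induces the chart $(\pi^{-1}(U),q^1,\dots,q^n,p_1,\dots,p_n)$ of $T^*M$, where $q^i=x^i\circ\pi$ and $p=p_i\,dx^i_{\pi(p)}$. With $\Gamma^k_{ih}$ the Christoffel symbols of $g$, put $\Gamma^0_{ih}=p_k\Gamma^k_{ih}$, $\frac{\delta}{\delta q^i}=\frac{\partial}{\partial q^i}+\Gamma^0_{ih}\frac{\partial}{\partial p_h}$, $Dp_i=dp_i-\Gamma^0_{ij}dq^j$. The vector fields $\frac{\delta}{\delta q^i},\frac{\partial}{\partial p_i}$ form a local frame with dual coframe $dq^i,Dp_i$. Further, $(g^{ij})$ is the inverse of $(g_{ij})$, $g^{0i}=p_hg^{hi}$, and $t=\frac12 g^{ij}p_ip_j>0$ on $T^*_0M$ is the energy density. The functions of $t$ (such as $\lambda$, $\mu$, $\lambda'=d\lambda/dt$) are evaluated at the energy density. The Hermitian structure $(G,J)$ is K\"ahler if its fundamental 2-form $\phi(X,Y)=G(X,JY)$ is closed. *)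

theory Defs
  imports "HOL-Analysis.Analysis"
begin

subsection \<open>Smooth functions\<close>

text \<open>\<^term>\<open>S\<close> is meant to be open. In finite dimension the iterated directional derivatives
  below characterise the class \<open>C^k\<close>.\<close>

primrec Ck_on :: "nat \<Rightarrow> 'a::euclidean_space set \<Rightarrow> ('a \<Rightarrow> 'b::real_normed_vector) \<Rightarrow> bool" where
  "Ck_on 0 S f \<longleftrightarrow> continuous_on S f"
| "Ck_on (Suc k) S f \<longleftrightarrow> (\<forall>x\<in>S. f differentiable (at x)) \<and>
     (\<forall>v. Ck_on k S (\<lambda>x. frechet_derivative f (at x) v))"

definition smooth_on :: "'a::euclidean_space set \<Rightarrow> ('a \<Rightarrow> 'b::real_normed_vector) \<Rightarrow> bool" where
  "smooth_on S f \<longleftrightarrow> (\<forall>k. Ck_on k S f)"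

definition partial :: "'n::finite \<Rightarrow> (real^'n \<Rightarrow> real) \<Rightarrow> real^'n \<Rightarrow> real" where
  "partial i f x = frechet_derivative f (at x) (axis i 1)"


subsection \<open>Smooth manifolds and Riemannian metrics\<close>

text \<open>A manifold of dimension \<open>CARD('n)\<close> is a Hausdorff, second countable type \<open>'m\<close> together with
  a smooth atlas. A chart is a pair \<open>(U, x)\<close>; the values of \<open>x\<close> outside \<open>U\<close> are irrelevant.\<close>

type_synonym ('m, 'n) chart = "'m set \<times> ('m \<Rightarrow> real^'n)"

abbreviation chart_dom :: "('m, 'n::finite) chart \<Rightarrow> 'm set" where
  "chart_dom C \<equiv> fst C"

abbreviation chart_image :: "('m, 'n::finite) chart \<Rightarrow> (real^'n) set" where
  "chart_image C \<equiv> snd C ` fst C"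

definition chart_inv :: "('m, 'n::finite) chart \<Rightarrow> real^'n \<Rightarrow> 'm" where
  "chart_inv C = inv_into (fst C) (snd C)"

definition is_chart :: "('m::topological_space, 'n::finite) chart \<Rightarrow> bool" where
  "is_chart C \<longleftrightarrow> open (chart_dom C) \<and> open (chart_image C) \<and>
     homeomorphism (chart_dom C) (chart_image C) (snd C) (chart_inv C)"

definition transition :: "('m, 'n::finite) chart \<Rightarrow> ('m, 'n) chart \<Rightarrow> real^'n \<Rightarrow> real^'n" where
  "transition C C' = snd C' \<circ> chart_inv C"

definition smooth_atlas ::
    "('m::{t2_space, second_countable_topology}, 'n::finite) chart set \<Rightarrow> bool" where
  "smooth_atlas \<A> \<longleftrightarrow> (\<forall>C\<in>\<A>. is_chart C) \<and> (\<Union>C\<in>\<A>. chart_dom C) = UNIV \<and>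
     (\<forall>C\<in>\<A>. \<forall>C'\<in>\<A>. smooth_on (snd C ` (chart_dom C \<inter> chart_dom C')) (transition C C'))"

text \<open>A tangent vector at \<open>m\<close> assigns to every chart around \<open>m\<close> its components in that chart,
  subject to the vector transformation law; it is set to \<open>0\<close> at all other arguments so
  that equal components mean equal vectors.\<close>

type_synonym ('m, 'n) tvec = "('m, 'n) chart \<Rightarrow> real^'n"

definition tangent_space ::
    "('m, 'n::finite) chart set \<Rightarrow> 'm \<Rightarrow> ('m, 'n) tvec set" where
  "tangent_space \<A> m = {v.
     (\<forall>C. \<not> (C \<in> \<A> \<and> m \<in> chart_dom C) \<longrightarrow> v C = 0) \<and>
     (\<forall>C\<in>\<A>. \<forall>C'\<in>\<A>. m \<in> chart_dom C \<inter> chart_dom C' \<longrightarrow>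
        v C' = frechet_derivative (transition C C') (at (snd C m)) (v C))}"

text \<open>The coordinate vector \<open>\<partial>/\<partial>x\<^sup>i\<close> at \<open>m\<close> of the chart \<open>C\<close>.\<close>

definition coord_vec ::
    "('m, 'n::finite) chart set \<Rightarrow> ('m, 'n) chart \<Rightarrow> 'm \<Rightarrow> 'n \<Rightarrow> ('m, 'n) tvec" where
  "coord_vec \<A> C m i = (\<lambda>C'. if C' \<in> \<A> \<and> m \<in> chart_dom C'
     then frechet_derivative (transition C C') (at (snd C m)) (axis i 1) else 0)"

definition metric_comp ::
    "('m, 'n::finite) chart set \<Rightarrow> ('m \<Rightarrow> ('m, 'n) tvec \<Rightarrow> ('m, 'n) tvec \<Rightarrow> real)
     \<Rightarrow> ('m, 'n) chart \<Rightarrow> real^'n \<Rightarrow> real^'n^'n" where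
  "metric_comp \<A> g C x = (\<chi> i j. let m = chart_inv C x in
     g m (coord_vec \<A> C m i) (coord_vec \<A> C m j))"

definition riemannian_metric ::
    "('m, 'n::finite) chart set \<Rightarrow> ('m \<Rightarrow> ('m, 'n) tvec \<Rightarrow> ('m, 'n) tvec \<Rightarrow> real) \<Rightarrow> bool" where
  "riemannian_metric \<A> g \<longleftrightarrow>
     (\<forall>m. \<forall>u\<in>tangent_space \<A> m. \<forall>v\<in>tangent_space \<A> m. \<forall>w\<in>tangent_space \<A> m. \<forall>a b.
        g m u v = g m v u \<and>
        g m (\<lambda>C. a *\<^sub>R u C + b *\<^sub>R v C) w = a * g m u w + b * g m v w \<and>
        (u \<noteq> (\<lambda>C. 0) \<longrightarrow> g m u u > 0)) \<and>
     (\<forall>C\<in>\<A>. \<forall>i j. smooth_on (chart_image C) (\<lambda>x. metric_comp \<A> g C x $ i $ j))"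


subsection \<open>Curvature in coordinates\<close>

text \<open>Here \<open>h\<close> is the matrix \<open>(g\<^sub>i\<^sub>j)\<close> of the metric in a chart, as a function of the coordinates.\<close>

definition ginv :: "(real^'n \<Rightarrow> real^'n^'n) \<Rightarrow> real^'n \<Rightarrow> 'n::finite \<Rightarrow> 'n \<Rightarrow> real" where
  "ginv h x i j = matrix_inv (h x) $ i $ j"

text \<open>\<open>christoffel h k i j\<close> is \<open>\<Gamma>\<^sup>k\<^sub>i\<^sub>j\<close>.\<close>

definition christoffel ::
    "(real^'n \<Rightarrow> real^'n^'n) \<Rightarrow> 'n::finite \<Rightarrow> 'n \<Rightarrow> 'n \<Rightarrow> real^'n \<Rightarrow> real" where
  "christoffel h k i j x = 1/2 * (\<Sum>l\<in>UNIV. ginv h x k l *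
     (partial i (\<lambda>y. h y $ j $ l) x + partial j (\<lambda>y. h y $ i $ l) x
      - partial l (\<lambda>y. h y $ i $ j) x))"

text \<open>\<open>riemann h l k i j\<close> is the component \<open>R\<^sup>l\<^sub>k\<^sub>i\<^sub>j\<close> in
  \<open>R(\<partial>\<^sub>i, \<partial>\<^sub>j) \<partial>\<^sub>k = R\<^sup>l\<^sub>k\<^sub>i\<^sub>j \<partial>\<^sub>l\<close>, where
  \<open>R(X,Y)Z = \<nabla>\<^sub>X\<nabla>\<^sub>Y Z - \<nabla>\<^sub>Y\<nabla>\<^sub>X Z - \<nabla>\<^bsub>[X,Y]\<^esub> Z\<close>.\<close>

definition riemann ::
    "(real^'n \<Rightarrow> real^'n^'n) \<Rightarrow> 'n::finite \<Rightarrow> 'n \<Rightarrow> 'n \<Rightarrow> 'n \<Rightarrow> real^'n \<Rightarrow> real" where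
  "riemann h l k i j x =
     partial i (christoffel h l j k) x - partial j (christoffel h l i k) x
     + (\<Sum>s\<in>UNIV. christoffel h l i s x * christoffel h s j k x
                - christoffel h l j s x * christoffel h s i k x)"

text \<open>\<open>K(v,w) = g(R(v,w)w, v) / (g(v,v) g(w,w) - g(v,w)\<^sup>2)\<close>.\<close>

definition sectional_curvature ::
    "(real^'n \<Rightarrow> real^'n^'n) \<Rightarrow> real^'n \<Rightarrow> real^'n \<Rightarrow> real^'n \<Rightarrow> real" where
  "sectional_curvature h x v w =
     (\<Sum>a\<in>UNIV. \<Sum>l\<in>UNIV. \<Sum>k\<in>UNIV. \<Sum>i\<in>UNIV. \<Sum>j\<in>UNIV.
        h x $ l $ a * riemann h l k i j x * v $ i * w $ j * w $ k * v $ a)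
     / ((v \<bullet> (h x *v v)) * (w \<bullet> (h x *v w)) - (v \<bullet> (h x *v w))\<^sup>2)"

definition constant_curvature ::
    "('m, 'n::finite) chart set \<Rightarrow> ('m \<Rightarrow> ('m, 'n) tvec \<Rightarrow> ('m, 'n) tvec \<Rightarrow> real)
     \<Rightarrow> real \<Rightarrow> bool" where
  "constant_curvature \<A> g c \<longleftrightarrow> (\<forall>C\<in>\<A>. \<forall>x\<in>chart_image C. \<forall>v w.
     v \<noteq> w \<and> independent {v, w} \<longrightarrow> sectional_curvature (metric_comp \<A> g C) x v w = c)"


subsection \<open>The cotangent bundle and its induced charts\<close>

text \<open>Covectors are linear functionals on the tangent space, set to \<open>0\<close> outside of it.\<close>

type_synonym ('m, 'n) covec = "('m, 'n) tvec \<Rightarrow> real"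

definition cotangent_space ::
    "('m, 'n::finite) chart set \<Rightarrow> 'm \<Rightarrow> ('m, 'n) covec set" where
  "cotangent_space \<A> m = {p.
     (\<forall>v. v \<notin> tangent_space \<A> m \<longrightarrow> p v = 0) \<and>
     (\<forall>v\<in>tangent_space \<A> m. \<forall>w\<in>tangent_space \<A> m. \<forall>a b.
        p (\<lambda>C. a *\<^sub>R v C + b *\<^sub>R w C) = a * p v + b * p w)}"

definition cotangent_bundle ::
    "('m, 'n::finite) chart set \<Rightarrow> ('m \<times> ('m, 'n) covec) set" where
  "cotangent_bundle \<A> = {(m, p). p \<in> cotangent_space \<A> m}"

definition cotangent_bundle0 ::
    "('m, 'n::finite) chart set \<Rightarrow> ('m \<times> ('m, 'n) covec) set" where
  "cotangent_bundle0 \<A> = {(m, p) \<in> cotangent_bundle \<A>. p \<noteq> (\<lambda>v. 0)}"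

text \<open>The coordinates \<open>(q, p)\<close> of a point of \<open>T\<^sup>*M\<close> in the chart induced by \<open>C\<close>, whose domain
  consists of the points with base point in \<open>chart_dom C\<close>.\<close>

definition cotangent_coords ::
    "('m, 'n::finite) chart set \<Rightarrow> ('m, 'n) chart \<Rightarrow> 'm \<times> ('m, 'n) covec
     \<Rightarrow> (real^'n) \<times> (real^'n)" where
  "cotangent_coords \<A> C P = (snd C (fst P), \<chi> i. snd P (coord_vec \<A> C (fst P) i))"


subsection \<open>The adapted frame and coframe\<close>

text \<open>In an induced chart, points and tangent vectors of \<open>T\<^sup>*M\<close> are both represented by elements of
  \<open>real^'n \<times> real^'n\<close>: the tangent vector \<open>(a, b)\<close> stands for
  \<open>a\<^sup>i \<partial>/\<partial>q\<^sup>i + b\<^sub>i \<partial>/\<partial>p\<^sub>i\<close>.\<close>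

definition Gamma0 ::
    "(real^'n \<Rightarrow> real^'n^'n) \<Rightarrow> (real^'n) \<times> (real^'n) \<Rightarrow> 'n::finite \<Rightarrow> 'n \<Rightarrow> real" where
  "Gamma0 h z i j = (\<Sum>k\<in>UNIV. snd z $ k * christoffel h k i j (fst z))"

definition delta_q ::
    "(real^'n \<Rightarrow> real^'n^'n) \<Rightarrow> (real^'n) \<times> (real^'n) \<Rightarrow> 'n::finite
     \<Rightarrow> (real^'n) \<times> (real^'n)" where
  "delta_q h z i = (axis i 1, \<chi> j. Gamma0 h z i j)"

definition partial_p :: "'n::finite \<Rightarrow> (real^'n) \<times> (real^'n)" where
  "partial_p i = (0, axis i 1)"

definition dq :: "'n::finite \<Rightarrow> (real^'n) \<times> (real^'n) \<Rightarrow> real" where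
  "dq i v = fst v $ i"

definition Dp ::
    "(real^'n \<Rightarrow> real^'n^'n) \<Rightarrow> (real^'n) \<times> (real^'n) \<Rightarrow> 'n::finite
     \<Rightarrow> (real^'n) \<times> (real^'n) \<Rightarrow> real" where
  "Dp h z i v = snd v $ i - (\<Sum>j\<in>UNIV. Gamma0 h z i j * dq j v)"

definition g0 ::
    "(real^'n \<Rightarrow> real^'n^'n) \<Rightarrow> (real^'n) \<times> (real^'n) \<Rightarrow> 'n::finite \<Rightarrow> real" where
  "g0 h z i = (\<Sum>k\<in>UNIV. snd z $ k * ginv h (fst z) k i)"

definition energy :: "(real^'n::finite \<Rightarrow> real^'n^'n) \<Rightarrow> (real^'n) \<times> (real^'n) \<Rightarrow> real" where
  "energy h z = 1/2 * (\<Sum>i\<in>UNIV. \<Sum>j\<in>UNIV. ginv h (fst z) i j * snd z $ i * snd z $ j)"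


subsection \<open>The structure \<open>(G, J)\<close>\<close>

definition J1 ::
    "real \<Rightarrow> real \<Rightarrow> (real \<Rightarrow> real) \<Rightarrow> (real^'n \<Rightarrow> real^'n^'n)
     \<Rightarrow> (real^'n) \<times> (real^'n) \<Rightarrow> 'n::finite \<Rightarrow> 'n \<Rightarrow> real" where
  "J1 A c lam h z i j = (let t = energy h z; l = lam t; l' = deriv lam t in
     A * t * l * h (fst z) $ i $ j
     + (c - A\<^sup>2 * t * l * (l + t * l')) / (A * t * (l + 2 * t * l')) * snd z $ i * snd z $ j)"

definition J2 ::
    "real \<Rightarrow> real \<Rightarrow> (real \<Rightarrow> real) \<Rightarrow> (real^'n \<Rightarrow> real^'n^'n)
     \<Rightarrow> (real^'n) \<times> (real^'n) \<Rightarrow> 'n::finite \<Rightarrow> 'n \<Rightarrow> real" where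
  "J2 A c lam h z i j = (let t = energy h z; l = lam t; l' = deriv lam t in
     1 / (A * t * l) * ginv h (fst z) i j
     - (c - A\<^sup>2 * t * l * (l + t * l')) / (A * t\<^sup>2 * l * (2 * c - A\<^sup>2 * t * l\<^sup>2))
       * g0 h z i * g0 h z j)"

definition J_loc ::
    "real \<Rightarrow> real \<Rightarrow> (real \<Rightarrow> real) \<Rightarrow> (real^'n \<Rightarrow> real^'n^'n)
     \<Rightarrow> (real^'n) \<times> (real^'n) \<Rightarrow> (real^'n::finite) \<times> (real^'n) \<Rightarrow> (real^'n) \<times> (real^'n)" where
  "J_loc A c lam h z v =
     (\<Sum>i\<in>UNIV. dq i v *\<^sub>R (\<Sum>j\<in>UNIV. J1 A c lam h z i j *\<^sub>R partial_p j))
     + (\<Sum>i\<in>UNIV. Dp h z i v *\<^sub>R (- (\<Sum>j\<in>UNIV. J2 A c lam h z i j *\<^sub>R delta_q h z j)))"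

definition coef_c1 :: "real \<Rightarrow> (real \<Rightarrow> real) \<Rightarrow> real \<Rightarrow> real" where
  "coef_c1 A lam t = A * t * (lam t)\<^sup>2"

definition coef_c2 :: "real \<Rightarrow> real \<Rightarrow> real" where
  "coef_c2 A t = 1 / (A * t)"

definition coef_d1 ::
    "real \<Rightarrow> real \<Rightarrow> (real \<Rightarrow> real) \<Rightarrow> (real \<Rightarrow> real) \<Rightarrow> real \<Rightarrow> real" where
  "coef_d1 A c lam mu t = (let l = lam t; l' = deriv lam t in
     (l * (c - A\<^sup>2 * t * l * (l + t * l')) + mu t * t * (2 * c - A\<^sup>2 * t * l\<^sup>2))
     / (A * t * (l + 2 * t * l')))"

definition coef_d2 ::
    "real \<Rightarrow> real \<Rightarrow> (real \<Rightarrow> real) \<Rightarrow> (real \<Rightarrow> real) \<Rightarrow> real \<Rightarrow> real" where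
  "coef_d2 A c lam mu t = (let l = lam t; l' = deriv lam t in
     (- c + A\<^sup>2 * t * l * (l + t * l') + mu t * A\<^sup>2 * t\<^sup>2 * (l + 2 * t * l'))
     / (A * t\<^sup>2 * (2 * c - A\<^sup>2 * t * l\<^sup>2)))"

definition G_loc ::
    "real \<Rightarrow> real \<Rightarrow> (real \<Rightarrow> real) \<Rightarrow> (real \<Rightarrow> real) \<Rightarrow> (real^'n \<Rightarrow> real^'n^'n)
     \<Rightarrow> (real^'n) \<times> (real^'n) \<Rightarrow> (real^'n::finite) \<times> (real^'n) \<Rightarrow> (real^'n) \<times> (real^'n) \<Rightarrow> real"
  where
  "G_loc A c lam mu h z v w = (let t = energy h z in
     (\<Sum>i\<in>UNIV. \<Sum>j\<in>UNIV.
        (coef_c1 A lam t * h (fst z) $ i $ j + coef_d1 A c lam mu t * snd z $ i * snd z $ j)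
        * dq i v * dq j w)
     + (\<Sum>i\<in>UNIV. \<Sum>j\<in>UNIV.
        (coef_c2 A t * ginv h (fst z) i j + coef_d2 A c lam mu t * g0 h z i * g0 h z j)
        * Dp h z i v * Dp h z j w))"


subsection \<open>Closedness of the fundamental form\<close>

definition ext_deriv2 ::
    "('e::real_normed_vector \<Rightarrow> 'e \<Rightarrow> 'e \<Rightarrow> real) \<Rightarrow> 'e \<Rightarrow> 'e \<Rightarrow> 'e \<Rightarrow> 'e \<Rightarrow> real" where
  "ext_deriv2 \<omega> z u v w =
     frechet_derivative (\<lambda>y. \<omega> y v w) (at z) u
     - frechet_derivative (\<lambda>y. \<omega> y u w) (at z) v
     + frechet_derivative (\<lambda>y. \<omega> y u v) (at z) w"

text \<open>Tensor fields on \<open>T\<^sup>*\<^sub>0M\<close> are given by their expressions in the charts induced by the charts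
  \<open>C\<close> of \<open>M\<close>; since these cover \<open>T\<^sup>*\<^sub>0M\<close> and the exterior derivative is local, a
  form is closed if and only if its exterior derivative vanishes in every induced chart.\<close>

definition closed_form0 ::
    "('m, 'n::finite) chart set
     \<Rightarrow> (('m, 'n) chart \<Rightarrow> (real^'n) \<times> (real^'n)
         \<Rightarrow> (real^'n) \<times> (real^'n) \<Rightarrow> (real^'n) \<times> (real^'n) \<Rightarrow> real) \<Rightarrow> bool" where
  "closed_form0 \<A> \<omega> \<longleftrightarrow> (\<forall>C\<in>\<A>. \<forall>P\<in>cotangent_bundle0 \<A>. fst P \<in> chart_dom C \<longrightarrow>
     (\<forall>u v w. ext_deriv2 (\<omega> C) (cotangent_coords \<A> C P) u v w = 0))"

definition fundamental_form ::
    "(('m, 'n::finite) chart \<Rightarrow> (real^'n) \<times> (real^'n)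
        \<Rightarrow> (real^'n) \<times> (real^'n) \<Rightarrow> (real^'n) \<times> (real^'n) \<Rightarrow> real)
     \<Rightarrow> (('m, 'n) chart \<Rightarrow> (real^'n) \<times> (real^'n)
        \<Rightarrow> (real^'n) \<times> (real^'n) \<Rightarrow> (real^'n) \<times> (real^'n))
     \<Rightarrow> ('m, 'n) chart \<Rightarrow> (real^'n) \<times> (real^'n)
     \<Rightarrow> (real^'n) \<times> (real^'n) \<Rightarrow> (real^'n) \<times> (real^'n) \<Rightarrow> real" where
  "fundamental_form G J C z v w = G C z v (J C z w)"

text \<open>A Hermitian structure \<open>(G, J)\<close> is Kaehler if its fundamental form is closed. The property
  of being Hermitian is not part of the predicate.\<close>

definition kaehler ::
    "('m, 'n::finite) chart set
     \<Rightarrow> (('m, 'n) chart \<Rightarrow> (real^'n) \<times> (real^'n)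
         \<Rightarrow> (real^'n) \<times> (real^'n) \<Rightarrow> (real^'n) \<times> (real^'n) \<Rightarrow> real)
     \<Rightarrow> (('m, 'n) chart \<Rightarrow> (real^'n) \<times> (real^'n)
         \<Rightarrow> (real^'n) \<times> (real^'n) \<Rightarrow> (real^'n) \<times> (real^'n)) \<Rightarrow> bool" where
  "kaehler \<A> G J \<longleftrightarrow> closed_form0 \<A> (fundamental_form G J)"

end

theory Submission
  imports Defs
begin

text \<open>Write \<open>\<Theta> = p\<^sub>i dq\<^sup>i\<close> for the tautological form, \<open>y\<^sup>i = g\<^sup>0\<^sup>i\<close> for the vector dual to \<open>p\<close>,
  and \<open>t\<close> for the energy. In the adapted frame the fundamental form pairs horizontal with vertical
  vectors only, and its blocks are products of the matrices of \<open>G\<close> and \<open>J\<close>. The coefficients are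
  such that these products are \<open>\<lambda> \<delta>\<^sup>i\<^sub>j + \<mu> p\<^sub>j y\<^sup>i\<close> up to sign, whence
  \<open>\<phi> = \<lambda> Dp\<^sub>i \<and> dq\<^sup>i + \<mu> y\<^sup>i Dp\<^sub>i \<and> \<Theta>\<close> (\<open>fundamental_form_eq\<close>).

  Two properties of the Levi-Civita connection remove the frame. It has no torsion, so
  \<open>Dp\<^sub>i \<and> dq\<^sup>i = dp\<^sub>i \<and> dq\<^sup>i = d\<Theta>\<close> (\<open>vertical_part_wedge\<close>). It preserves the metric, so the
  energy is constant in horizontal directions and \<open>y\<^sup>i Dp\<^sub>i = dt\<close> (\<open>energy_derivative_frame\<close>).
  Therefore \<open>\<phi> = \<lambda>(t) d\<Theta> + \<mu>(t) dt \<and> \<Theta>\<close> and \<open>d\<phi> = (\<lambda>' - \<mu>) dt \<and> d\<Theta>\<close>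
  (\<open>ext_deriv2_fundamental\<close>).

  If \<open>\<mu> = \<lambda>'\<close> this vanishes. Conversely, \<open>dt \<and> d\<Theta>\<close> has no zeros off the zero section when
  \<open>n > 1\<close> (\<open>ext_deriv2_witness\<close>), and every \<open>t > 0\<close> is the energy of some covector, so \<open>d\<phi> = 0\<close>
  forces \<open>\<mu>(t) = \<lambda>'(t)\<close> for all \<open>t > 0\<close>.\<close>

section \<open>Symmetry of second derivatives\<close>

text \<open>The mean value theorem in the direction \<open>u\<close> turns the second difference into a
  first difference of \<open>y \<mapsto> Df(y) u\<close>, which differentiability of that map at the single point
  \<open>x\<close> controls.\<close>

lemma second_difference_approx:
  fixes f :: "'a::real_normed_vector \<Rightarrow> real"
  assumes "open S" "x \<in> S" and diff: "\<And>y. y \<in> S \<Longrightarrow> f differentiable (at y)"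
    and der: "((\<lambda>y. frechet_derivative f (at y) u) has_derivative L) (at x)" and "e > 0"
  shows "\<forall>\<^sub>F t in at_right 0.
    \<bar>f (x + t *\<^sub>R u + t *\<^sub>R v) - f (x + t *\<^sub>R u) - f (x + t *\<^sub>R v) + f x - t\<^sup>2 * L v\<bar> \<le> e * t\<^sup>2"
proof -
  define D where "D = (\<lambda>y. frechet_derivative f (at y))"
  \<comment> \<open>All points involved lie within \<open>t * K\<close> of \<open>x\<close>, and the two linearisation errors
    add up to at most \<open>(e / K) * (t * K)\<close>.\<close>
  define K where "K = 2 * norm u + norm v + 1"
  have K: "K > 0" unfolding K_def by (smt (verit) norm_ge_zero)
  have L: "bounded_linear L" using der by (rule has_derivative_bounded_linear)
  obtain r where r: "r > 0" "ball x r \<subseteq> S" using assms(1,2) by (meson openE)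
  have "\<exists>d>0. \<forall>y. norm (y - x) < d \<longrightarrow> norm (D y u - D x u - L (y - x)) \<le> (e / K) * norm (y - x)"
    using der divide_pos_pos[OF assms(5) K] unfolding has_derivative_at_alt D_def by blast
  then obtain d where d: "d > 0"
    "\<And>y. norm (y - x) < d \<Longrightarrow> \<bar>D y u - D x u - L (y - x)\<bar> \<le> (e / K) * norm (y - x)" by auto
  define m where "m = min r d / K"
  have m: "m > 0" using r d K by (simp add: m_def)
  have main: "\<bar>f (x + t *\<^sub>R u + t *\<^sub>R v) - f (x + t *\<^sub>R u) - f (x + t *\<^sub>R v) + f x - t\<^sup>2 * L v\<bar> \<le> e * t\<^sup>2"
    if t: "0 < t" "t < m" for t
  proof -
    have near: "norm (s *\<^sub>R u + w *\<^sub>R v) < min r d" if "0 \<le> s" "s \<le> t" "0 \<le> w" "w \<le> t" for s w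
    proof -
      have "norm (s *\<^sub>R u + w *\<^sub>R v) \<le> s * norm u + w * norm v"
        using that by (metis abs_of_nonneg norm_scaleR norm_triangle_ineq)
      also have "\<dots> \<le> t * norm u + t * norm v"
        using that by (intro add_mono mult_right_mono) auto
      also have "\<dots> \<le> t * K" using t by (simp add: K_def algebra_simps)
      also have "\<dots> < m * K" using t K by simp
      finally show ?thesis using K by (simp add: m_def)
    qed
    have inS: "x + s *\<^sub>R u + w *\<^sub>R v \<in> S" if "0 \<le> s" "s \<le> t" "0 \<le> w" "w \<le> t" for s w
    proof -
      have "dist x (x + s *\<^sub>R u + w *\<^sub>R v) < r"
        using near[OF that] by (subst dist_commute) (simp add: dist_norm add.assoc)
      then show ?thesis using r by (auto simp: subset_iff)
    qed
    have line: "((\<lambda>s. f (x + s *\<^sub>R u + w *\<^sub>R v)) has_real_derivative D (x + s *\<^sub>R u + w *\<^sub>R v) u) (at s)"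
      if "0 \<le> s" "s \<le> t" "0 \<le> w" "w \<le> t" for s w
    proof -
      have "(f has_derivative D (x + s *\<^sub>R u + w *\<^sub>R v)) (at (x + s *\<^sub>R u + w *\<^sub>R v))"
        using diff[OF inS[OF that]] by (simp add: D_def frechet_derivative_works)
      moreover have "((\<lambda>s. x + s *\<^sub>R u + w *\<^sub>R v) has_derivative (\<lambda>k. k *\<^sub>R u)) (at s)"
        by (auto intro!: derivative_eq_intros)
      ultimately have *: "((\<lambda>s. f (x + s *\<^sub>R u + w *\<^sub>R v)) has_derivative
          (\<lambda>k. D (x + s *\<^sub>R u + w *\<^sub>R v) (k *\<^sub>R u))) (at s)"
        by (metis has_derivative_compose)
      have "linear (D (x + s *\<^sub>R u + w *\<^sub>R v))"
        using diff[OF inS[OF that]] unfolding D_def by (rule linear_frechet_derivative)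
      then have "(\<lambda>k. D (x + s *\<^sub>R u + w *\<^sub>R v) (k *\<^sub>R u)) = (\<lambda>k. k * D (x + s *\<^sub>R u + w *\<^sub>R v) u)"
        by (simp add: linear_scale)
      with * show ?thesis by (simp add: has_field_derivative_def mult.commute[of _ "D _ u"])
    qed
    define k where "k s = f (x + s *\<^sub>R u + t *\<^sub>R v) - f (x + s *\<^sub>R u)" for s
    have "(k has_real_derivative
        (D (x + s *\<^sub>R u + t *\<^sub>R v) u - D (x + s *\<^sub>R u) u)) (at s)" if "0 \<le> s" "s \<le> t" for s
      unfolding k_def using line[OF that, of t] line[OF that, of 0] t
      by (auto intro!: DERIV_diff)
    from MVT2[OF t(1) this] obtain \<xi> where \<xi>: "0 < \<xi>" "\<xi> < t"
      "k t - k 0 = t * (D (x + \<xi> *\<^sub>R u + t *\<^sub>R v) u - D (x + \<xi> *\<^sub>R u) u)" by auto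
    have a: "\<bar>D (x + \<xi> *\<^sub>R u + w *\<^sub>R v) u - D x u - L (\<xi> *\<^sub>R u + w *\<^sub>R v)\<bar>
        \<le> (e / K) * norm (\<xi> *\<^sub>R u + w *\<^sub>R v)" if "0 \<le> w" "w \<le> t" for w
      using d(2)[of "x + \<xi> *\<^sub>R u + w *\<^sub>R v"] near[of \<xi> w] \<xi> that by (simp add: add.assoc)
    have "L (\<xi> *\<^sub>R u + t *\<^sub>R v) = L (\<xi> *\<^sub>R u) + t * L v"
      using L by (simp add: bounded_linear.linear linear_add linear_scale)
    then have "\<bar>(D (x + \<xi> *\<^sub>R u + t *\<^sub>R v) u - D (x + \<xi> *\<^sub>R u) u) - t * L v\<bar>
        \<le> (e / K) * norm (\<xi> *\<^sub>R u + t *\<^sub>R v) + (e / K) * norm (\<xi> *\<^sub>R u)"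
      using a[of t] a[of 0] t by simp
    also have "\<dots> = (e / K) * (norm (\<xi> *\<^sub>R u + t *\<^sub>R v) + norm (\<xi> *\<^sub>R u))"
      by (simp add: distrib_left)
    also have "\<dots> \<le> (e / K) * (t * K)"
    proof (rule mult_left_mono)
      have "norm (\<xi> *\<^sub>R u + t *\<^sub>R v) + norm (\<xi> *\<^sub>R u) \<le> 2 * (\<xi> * norm u) + t * norm v"
        using \<xi> t norm_triangle_ineq[of "\<xi> *\<^sub>R u" "t *\<^sub>R v"] by simp
      also have "\<dots> \<le> 2 * (t * norm u) + t * norm v"
        using \<xi> by (simp add: mult_right_mono)
      also have "\<dots> \<le> t * K" using t by (simp add: K_def algebra_simps)
      finally show "norm (\<xi> *\<^sub>R u + t *\<^sub>R v) + norm (\<xi> *\<^sub>R u) \<le> t * K" .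
    qed (use assms(5) K in simp)
    also have "\<dots> = e * t" using K by simp
    finally have b: "\<bar>(D (x + \<xi> *\<^sub>R u + t *\<^sub>R v) u - D (x + \<xi> *\<^sub>R u) u) - t * L v\<bar> \<le> e * t" .
    have "\<bar>k t - k 0 - t\<^sup>2 * L v\<bar>
        = t * \<bar>(D (x + \<xi> *\<^sub>R u + t *\<^sub>R v) u - D (x + \<xi> *\<^sub>R u) u) - t * L v\<bar>"
    proof -
      have "k t - k 0 - t\<^sup>2 * L v = t * ((D (x + \<xi> *\<^sub>R u + t *\<^sub>R v) u - D (x + \<xi> *\<^sub>R u) u) - t * L v)"
        unfolding \<xi>(3) by (simp add: power2_eq_square algebra_simps)
      then show ?thesis using t by (simp only: abs_mult abs_of_pos)
    qed
    also have "\<dots> \<le> t * (e * t)" using b t by (intro mult_left_mono) auto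
    finally show ?thesis by (simp add: k_def power2_eq_square algebra_simps)
  qed
  show ?thesis
    using m main by (auto simp: eventually_at_right_field intro!: exI[of _ m])
qed

text \<open>The second difference is symmetric in \<open>u\<close> and \<open>v\<close>, so both iterated derivatives
  are its limit after division by \<open>t\<^sup>2\<close>.\<close>

lemma second_derivative_symmetric:
  fixes f :: "'a::real_normed_vector \<Rightarrow> real"
  assumes "open S" "x \<in> S" and "\<And>y. y \<in> S \<Longrightarrow> f differentiable (at y)"
    and "(\<lambda>y. frechet_derivative f (at y) u) differentiable (at x)"
    and "(\<lambda>y. frechet_derivative f (at y) v) differentiable (at x)"
  shows "frechet_derivative (\<lambda>y. frechet_derivative f (at y) u) (at x) v
       = frechet_derivative (\<lambda>y. frechet_derivative f (at y) v) (at x) u" (is "?a = ?b")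
proof -
  have "\<bar>?a - ?b\<bar> \<le> 0 + e" if "e > 0" for e :: real
  proof -
    have e: "e / 2 > 0" using that by simp
    have 1: "\<forall>\<^sub>F t in at_right 0. \<bar>f (x + t *\<^sub>R u + t *\<^sub>R v) - f (x + t *\<^sub>R u)
        - f (x + t *\<^sub>R v) + f x - t\<^sup>2 * ?a\<bar> \<le> e / 2 * t\<^sup>2"
      using assms e by (intro second_difference_approx[of S]) (auto simp: frechet_derivative_works)
    have 2: "\<forall>\<^sub>F t in at_right 0. \<bar>f (x + t *\<^sub>R v + t *\<^sub>R u) - f (x + t *\<^sub>R v)
        - f (x + t *\<^sub>R u) + f x - t\<^sup>2 * ?b\<bar> \<le> e / 2 * t\<^sup>2"
      using assms e by (intro second_difference_approx[of S]) (auto simp: frechet_derivative_works)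
    have "\<forall>\<^sub>F t::real in at_right 0. t > 0" by (simp add: eventually_at_right_less)
    with 1 2 have "\<forall>\<^sub>F t::real in at_right 0. \<bar>?a - ?b\<bar> \<le> 0 + e"
    proof eventually_elim
      case (elim t)
      moreover have "x + t *\<^sub>R v + t *\<^sub>R u = x + t *\<^sub>R u + t *\<^sub>R v" by simp
      ultimately have "\<bar>t\<^sup>2 * ?a - t\<^sup>2 * ?b\<bar> \<le> e / 2 * t\<^sup>2 + e / 2 * t\<^sup>2" by (simp only:)
      then have "\<bar>t\<^sup>2 * ?a - t\<^sup>2 * ?b\<bar> \<le> e * t\<^sup>2" by simp
      then have "t\<^sup>2 * \<bar>?a - ?b\<bar> \<le> t\<^sup>2 * e"
        by (simp add: abs_mult mult.commute flip: right_diff_distrib)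
      then show ?case using elim by simp
    qed
    then show ?thesis by simp
  qed
  then have "\<bar>?a - ?b\<bar> \<le> 0" by (rule field_le_epsilon)
  then show ?thesis by simp
qed

section \<open>Twice differentiable functions\<close>

text \<open>What the symmetry of second derivatives requires; the first two levels of
  smoothness imply it.\<close>

definition twice_differentiable_on :: "'a::real_normed_vector set \<Rightarrow> ('a \<Rightarrow> real) \<Rightarrow> bool" where
  "twice_differentiable_on S f \<longleftrightarrow> (\<forall>x\<in>S. f differentiable (at x) \<and>
     (\<forall>v. (\<lambda>y. frechet_derivative f (at y) v) differentiable (at x)))"

lemma smooth_imp_twice_differentiable_on:
  assumes "smooth_on S f" shows "twice_differentiable_on S f"
proof -
  have "Ck_on (Suc (Suc 0)) S f" using assms by (simp only: smooth_on_def)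
  then show ?thesis by (simp add: twice_differentiable_on_def)
qed

lemma twice_differentiable_onI:
  assumes "open S" and f: "\<And>x. x \<in> S \<Longrightarrow> (f has_derivative f' x) (at x)"
    and f': "\<And>x v. x \<in> S \<Longrightarrow> (\<lambda>y. f' y v) differentiable (at x)"
  shows "twice_differentiable_on S f"
  unfolding twice_differentiable_on_def
proof (intro ballI conjI allI)
  fix x v assume x: "x \<in> S"
  show "f differentiable (at x)" using f[OF x] by (auto simp: differentiable_def)
  obtain L where "((\<lambda>y. f' y v) has_derivative L) (at x)"
    using f'[OF x, of v] by (auto simp: differentiable_def)
  then have "((\<lambda>y. frechet_derivative f (at y) v) has_derivative L) (at x)"
    by (rule has_derivative_transform_within_open[OF _ assms(1) x])
       (simp add: frechet_derivative_at[OF f, symmetric])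
  then show "(\<lambda>y. frechet_derivative f (at y) v) differentiable (at x)"
    by (auto simp: differentiable_def)
qed

lemma twice_differentiable_onD:
  assumes "twice_differentiable_on S f" "x \<in> S"
  shows "f differentiable (at x)"
    "(f has_derivative frechet_derivative f (at x)) (at x)"
    "(\<lambda>y. frechet_derivative f (at y) v) differentiable (at x)"
  using assms by (auto simp: twice_differentiable_on_def frechet_derivative_works)

lemma twice_differentiable_on_const: "open S \<Longrightarrow> twice_differentiable_on S (\<lambda>x. c)"
  by (rule twice_differentiable_onI[where f' = "\<lambda>_ _. 0"]) auto

lemma twice_differentiable_on_bounded_linear:
  assumes "bounded_linear f" "open S" shows "twice_differentiable_on S f"
  by (rule twice_differentiable_onI[OF assms(2) bounded_linear_imp_has_derivative[OF assms(1)]]) simp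

lemma twice_differentiable_on_add:
  assumes "open S" "twice_differentiable_on S f" "twice_differentiable_on S g"
  shows "twice_differentiable_on S (\<lambda>x. f x + g x)"
  by (rule twice_differentiable_onI[OF assms(1) has_derivative_add])
     (use assms in \<open>auto intro!: differentiable_add dest: twice_differentiable_onD\<close>)

lemma twice_differentiable_on_mult:
  assumes "open S" "twice_differentiable_on S f" "twice_differentiable_on S g"
  shows "twice_differentiable_on S (\<lambda>x. f x * g x)"
  by (rule twice_differentiable_onI[OF assms(1) has_derivative_mult])
     (use assms in \<open>auto intro!: differentiable_add differentiable_mult dest: twice_differentiable_onD\<close>)

lemma twice_differentiable_on_inverse:
  assumes "open S" "twice_differentiable_on S f" "\<And>x. x \<in> S \<Longrightarrow> f x \<noteq> 0"
  shows "twice_differentiable_on S (\<lambda>x. inverse (f x))"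
  by (rule twice_differentiable_onI[OF assms(1) Deriv.has_derivative_inverse[OF assms(3)
        twice_differentiable_onD(2)[OF assms(2)]]])
     (use assms in \<open>auto intro!: differentiable_minus differentiable_mult differentiable_inverse
        dest: twice_differentiable_onD\<close>)

lemma twice_differentiable_on_sum:
  assumes "open S" "\<And>i. i \<in> I \<Longrightarrow> twice_differentiable_on S (f i)"
  shows "twice_differentiable_on S (\<lambda>x. \<Sum>i\<in>I. f i x)"
  using assms(2)
  by (induction I rule: infinite_finite_induct)
     (auto intro!: twice_differentiable_on_const twice_differentiable_on_add assms(1))

lemma twice_differentiable_on_prod:
  assumes "open S" "\<And>i. i \<in> I \<Longrightarrow> twice_differentiable_on S (f i)"
  shows "twice_differentiable_on S (\<lambda>x. \<Prod>i\<in>I. f i x)"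
  using assms(2)
  by (induction I rule: infinite_finite_induct)
     (auto intro!: twice_differentiable_on_const twice_differentiable_on_mult assms(1))

lemma twice_differentiable_on_fst:
  fixes f :: "'a::real_normed_vector \<Rightarrow> real"
  assumes "open S" "twice_differentiable_on S f"
  shows "twice_differentiable_on (S \<times> (UNIV :: 'b::real_normed_vector set)) (\<lambda>z. f (fst z))"
proof (rule twice_differentiable_onI[where f' = "\<lambda>z v. frechet_derivative f (at (fst z)) (fst v)"])
  show "open (S \<times> (UNIV :: 'b set))" using assms(1) by (simp add: open_Times)
  fix z v :: "'a \<times> 'b" assume z: "z \<in> S \<times> UNIV"
  have fst: "(fst has_derivative fst) (at z)"
    by (simp add: bounded_linear_fst bounded_linear_imp_has_derivative)
  show "((\<lambda>z. f (fst z)) has_derivative (\<lambda>v. frechet_derivative f (at (fst z)) (fst v))) (at z)"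
    using has_derivative_compose[OF fst twice_differentiable_onD(2)[OF assms(2)]] z by auto
  obtain L where "((\<lambda>y. frechet_derivative f (at y) (fst v)) has_derivative L) (at (fst z))"
    using twice_differentiable_onD(3)[OF assms(2), of "fst z" "fst v"] z by (auto simp: differentiable_def)
  from has_derivative_compose[OF fst this]
  show "(\<lambda>z. frechet_derivative f (at (fst z)) (fst v)) differentiable at z"
    by (auto simp: differentiable_def)
qed

lemma twice_differentiable_on_det:
  fixes M :: "'a::real_normed_vector \<Rightarrow> real^'n^'n"
  assumes "open S" "\<And>i j. twice_differentiable_on S (\<lambda>x. M x $ i $ j)"
  shows "twice_differentiable_on S (\<lambda>x. det (M x))"
  unfolding det_def
  by (intro twice_differentiable_on_sum twice_differentiable_on_mult twice_differentiable_on_prod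
        twice_differentiable_on_const assms)

lemma matrix_inv_mult:
  fixes M :: "real^'n^'n"
  assumes "invertible M"
  shows "M ** matrix_inv M = mat 1" "matrix_inv M ** M = mat 1"
  using someI_ex[OF assms[unfolded invertible_def]] by (auto simp: matrix_inv_def)

text \<open>By Cramer's rule the entries of the inverse are quotients of determinants.\<close>

lemma twice_differentiable_on_matrix_inv:
  fixes M :: "'a::real_normed_vector \<Rightarrow> real^'n^'n"
  assumes S: "open S" and M: "\<And>i j. twice_differentiable_on S (\<lambda>x. M x $ i $ j)"
    and inv: "\<And>x. x \<in> S \<Longrightarrow> invertible (M x)"
  shows "twice_differentiable_on S (\<lambda>x. matrix_inv (M x) $ k $ j)"
proof -
  \<comment> \<open>the matrix in the numerator of Cramer's rule for the \<open>k\<close>-th entry of column \<open>j\<close>\<close>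
  define N where "N x = (\<chi> a b. if b = k then (axis j 1 :: real^'n) $ a else M x $ a $ b)" for x
  have det: "det (M x) \<noteq> 0" if "x \<in> S" for x using inv[OF that] by (simp add: invertible_det_nz)
  have "matrix_inv (M x) $ k $ j = det (N x) * inverse (det (M x))" if x: "x \<in> S" for x
  proof -
    have "M x *v (matrix_inv (M x) *v axis j 1) = axis j 1"
      by (simp add: matrix_vector_mul_assoc matrix_inv_mult(1)[OF inv[OF x]])
    then have "matrix_inv (M x) *v axis j 1 =
        (\<chi> k. det (\<chi> a b. if b = k then (axis j 1 :: real^'n) $ a else M x $ a $ b) / det (M x))"
      using cramer[OF det[OF x]] by blast
    then have "(matrix_inv (M x) *v axis j 1) $ k = det (N x) / det (M x)" by (simp add: N_def)
    moreover have "(matrix_inv (M x) *v axis j 1) $ k = matrix_inv (M x) $ k $ j"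
      by (simp add: matrix_vector_mult_basis column_def)
    ultimately show ?thesis by (simp add: divide_inverse)
  qed
  note eq = this
  have "twice_differentiable_on S (\<lambda>x. N x $ a $ b)" for a b
    using M[of a b] twice_differentiable_on_const[OF S] by (cases "b = k") (auto simp: N_def)
  then have "twice_differentiable_on S (\<lambda>x. det (N x) * inverse (det (M x)))"
    using det by (intro twice_differentiable_on_mult twice_differentiable_on_inverse
        twice_differentiable_on_det S M) auto
  note t = twice_differentiable_onD[OF this]
  show ?thesis
    by (rule twice_differentiable_onI[OF S has_derivative_transform_within_open[OF t(2) S]])
       (use eq t(3) in auto)
qed

section \<open>The energy density in an induced chart\<close>

text \<open>The canonical symplectic form \<open>dp\<^sub>i \<and> dq\<^sup>i\<close>; it is \<open>d\<Theta>\<close> for the tautological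
  form \<open>\<Theta> = p\<^sub>i dq\<^sup>i\<close>.\<close>

definition dp_wedge_dq ::
    "(real^'n::finite) \<times> (real^'n) \<Rightarrow> (real^'n) \<times> (real^'n) \<Rightarrow> real" where
  "dp_wedge_dq v w = snd v \<bullet> fst w - snd w \<bullet> fst v"

text \<open>The matrix of a metric on the image \<open>S\<close> of one chart. The values of \<open>h\<close>
  elsewhere are arbitrary, so identities between entries may be differentiated only because \<open>S\<close>
  is open.\<close>

locale coordinate_metric =
  fixes h :: "real^'n::finite \<Rightarrow> real^'n^'n" and S :: "(real^'n) set"
  assumes open_S: "open S"
    and h_twice: "\<And>i j. twice_differentiable_on S (\<lambda>x. h x $ i $ j)"
    and h_sym: "\<And>x i j. x \<in> S \<Longrightarrow> h x $ i $ j = h x $ j $ i"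
    and h_pos: "\<And>x a. x \<in> S \<Longrightarrow> a \<noteq> 0 \<Longrightarrow> a \<bullet> (h x *v a) > 0"
begin

lemma invertible_h: assumes "x \<in> S" shows "invertible (h x)"
proof -
  have "a = 0" if "h x *v a = 0" for a
    using h_pos[OF assms, of a] that by (cases "a = 0") auto
  then show ?thesis by (metis invertible_left_inverse matrix_left_invertible_ker)
qed

lemma transpose_h: "x \<in> S \<Longrightarrow> transpose (h x) = h x"
  by (simp add: transpose_def vec_eq_iff h_sym)

lemma ginv_sym: assumes "x \<in> S" shows "ginv h x i j = ginv h x j i"
proof -
  note inv = matrix_inv_mult[OF invertible_h[OF assms]]
  have "transpose (matrix_inv (h x)) ** transpose (h x) = mat 1"
    using inv(1) by (metis matrix_transpose_mul transpose_mat)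
  then have "transpose (matrix_inv (h x)) ** h x = mat 1"
    by (simp add: transpose_h[OF assms])
  then have "transpose (matrix_inv (h x)) = matrix_inv (h x)"
    using inv by (metis matrix_mul_assoc matrix_mul_lid matrix_mul_rid)
  then have "transpose (matrix_inv (h x)) $ i $ j = matrix_inv (h x) $ i $ j" by simp
  then show ?thesis by (simp add: transpose_def ginv_def)
qed

lemma h_mult_ginv:
  assumes "x \<in> S"
  shows "h x *v (matrix_inv (h x) *v a) = a" "matrix_inv (h x) *v (h x *v a) = a"
  using matrix_inv_mult[OF invertible_h[OF assms]]
  by (simp_all add: matrix_vector_mul_assoc)

lemma h_selfadjoint: "x \<in> S \<Longrightarrow> a \<bullet> (h x *v b) = (h x *v a) \<bullet> b"
  by (metis dot_lmul_matrix transpose_h transpose_matrix_vector)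

text \<open>The vector \<open>y\<close> with \<open>y\<^sup>i = g\<^sup>0\<^sup>i\<close>, dual with respect to the metric to \<open>p\<close>.\<close>

definition raise :: "(real^'n) \<times> (real^'n) \<Rightarrow> real^'n" where
  "raise z = matrix_inv (h (fst z)) *v snd z"

lemma h_raise: "fst z \<in> S \<Longrightarrow> h (fst z) *v raise z = snd z"
  by (simp add: raise_def h_mult_ginv)

lemma raise_nonzero: "fst z \<in> S \<Longrightarrow> snd z \<noteq> 0 \<Longrightarrow> raise z \<noteq> 0"
  using h_raise[of z] by auto

lemma g0_eq_raise: "fst z \<in> S \<Longrightarrow> g0 h z i = raise z $ i"
  using ginv_sym[of "fst z" _ i]
  by (simp add: g0_def raise_def matrix_vector_mult_def flip: ginv_def) (simp add: mult.commute)

lemma energy_eq: "energy h z = 1/2 * (snd z \<bullet> raise z)"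
  unfolding energy_def raise_def matrix_vector_mult_def inner_vec_def ginv_def
  by (simp add: sum_distrib_left mult_ac)

lemma energy_eq_h: "fst z \<in> S \<Longrightarrow> energy h z = 1/2 * (raise z \<bullet> (h (fst z) *v raise z))"
  by (simp add: energy_eq h_raise inner_commute)

lemma energy_pos: "fst z \<in> S \<Longrightarrow> snd z \<noteq> 0 \<Longrightarrow> energy h z > 0"
  by (simp add: energy_eq_h h_pos raise_nonzero)

text \<open>The energy is homogeneous of degree two in \<open>p\<close>, so scaling reaches every level.\<close>

lemma ex_covector_with_energy:
  assumes "x \<in> S" "t > 0"
  obtains \<xi> where "\<xi> \<noteq> 0" "energy h (x, \<xi>) = t"
proof -
  define e :: "real^'n" where "e = (\<Sum>i\<in>UNIV. axis i 1)"
  have "e $ i = 1" for i by (simp add: e_def axis_def)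
  then have e: "e \<noteq> 0" by (auto simp: vec_eq_iff)
  define s where "s = energy h (x, e)"
  have s: "s > 0" unfolding s_def by (rule energy_pos) (use assms e in auto)
  have "energy h (x, r *\<^sub>R e) = r\<^sup>2 * s" for r
    by (simp add: s_def energy_eq raise_def matrix_vector_mult_scaleR power2_eq_square)
  then have "energy h (x, sqrt (t / s) *\<^sub>R e) = (sqrt (t / s))\<^sup>2 * s" .
  also have "\<dots> = t" using s assms by simp
  finally show ?thesis using s e assms by (intro that[of "sqrt (t / s) *\<^sub>R e"]) auto
qed

lemma energy_twice: "twice_differentiable_on (S \<times> UNIV) (energy h)"
proof -
  have o: "open (S \<times> (UNIV :: (real^'n) set))" using open_S by (simp add: open_Times)
  have "twice_differentiable_on (S \<times> (UNIV :: (real^'n) set)) (\<lambda>z. ginv h (fst z) i j)" for i j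
    unfolding ginv_def
    by (rule twice_differentiable_on_fst[OF open_S
          twice_differentiable_on_matrix_inv[OF open_S h_twice invertible_h]])
  moreover have "twice_differentiable_on (S \<times> UNIV) (\<lambda>z :: (real^'n) \<times> (real^'n). snd z $ i)" for i
    by (rule twice_differentiable_on_bounded_linear[OF _ o])
       (rule bounded_linear_compose[OF bounded_linear_vec_nth bounded_linear_snd])
  ultimately have "twice_differentiable_on (S \<times> UNIV)
      (\<lambda>z. 1/2 * (\<Sum>i\<in>UNIV. \<Sum>j\<in>UNIV. ginv h (fst z) i j * snd z $ i * snd z $ j))"
    by (intro twice_differentiable_on_mult twice_differentiable_on_sum twice_differentiable_on_const o)
  then show ?thesis by (simp add: energy_def[abs_def])
qed

lemma h_has_derivative:
  assumes "x \<in> S"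
  shows "((\<lambda>x. h x $ i $ j) has_derivative (\<lambda>v. \<Sum>k\<in>UNIV. v $ k * partial k (\<lambda>y. h y $ i $ j) x)) (at x)"
proof -
  let ?D = "frechet_derivative (\<lambda>x. h x $ i $ j) (at x)"
  have d: "((\<lambda>x. h x $ i $ j) has_derivative ?D) (at x)"
    by (rule twice_differentiable_onD(2)[OF h_twice assms])
  have "?D v = (\<Sum>k\<in>UNIV. v $ k * partial k (\<lambda>y. h y $ i $ j) x)" for v
  proof -
    have "?D v = ?D (\<Sum>k\<in>UNIV. v $ k *\<^sub>R axis k 1)"
      by (simp add: basis_expansion flip: scalar_mult_eq_scaleR)
    also have "\<dots> = (\<Sum>k\<in>UNIV. v $ k * partial k (\<lambda>y. h y $ i $ j) x)"
      using has_derivative_linear[OF d] by (simp add: linear_sum linear_scale partial_def o_def)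
    finally show ?thesis .
  qed
  with d show ?thesis by (metis (no_types, lifting) ext)
qed

lemma partial_h_sym:
  assumes "x \<in> S" shows "partial k (\<lambda>y. h y $ i $ j) x = partial k (\<lambda>y. h y $ j $ i) x"
proof -
  have "frechet_derivative (\<lambda>y. h y $ i $ j) (at x) = frechet_derivative (\<lambda>y. h y $ j $ i) (at x)"
    by (rule frechet_derivative_transform_within_open[OF twice_differentiable_onD(1)[OF h_twice assms]
          open_S assms]) (rule h_sym)
  then show ?thesis by (simp add: partial_def)
qed

lemma quadratic_form_sum: "a \<bullet> (h x *v a) = (\<Sum>i\<in>UNIV. \<Sum>j\<in>UNIV. a $ i * a $ j * h x $ i $ j)"
  by (simp add: inner_vec_def matrix_vector_mult_def sum_distrib_left mult_ac)

text \<open>With \<open>y\<close> the dual vector of \<open>p\<close> at \<open>z\<close>, kept constant, the energy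
  is bounded below by \<open>p\<^sub>i y\<^sup>i - 1/2 g\<^sub>i\<^sub>j y\<^sup>i y\<^sup>j\<close> with equality at \<open>z\<close> (Legendre duality). So both
  functions have the same derivative at \<open>z\<close>, and the second one does not involve the inverse
  matrix.\<close>

lemma energy_has_derivative:
  assumes z: "fst z \<in> S"
  shows "(energy h has_derivative (\<lambda>v. raise z \<bullet> snd v - 1/2 * (\<Sum>i\<in>UNIV. \<Sum>j\<in>UNIV.
     raise z $ i * raise z $ j * (\<Sum>k\<in>UNIV. fst v $ k * partial k (\<lambda>y. h y $ i $ j) (fst z))))) (at z)"
proof -
  let ?y = "raise z"
  define L where "L v = ?y \<bullet> snd v - 1/2 * (\<Sum>i\<in>UNIV. \<Sum>j\<in>UNIV.
     ?y $ i * ?y $ j * (\<Sum>k\<in>UNIV. fst v $ k * partial k (\<lambda>y. h y $ i $ j) (fst z)))"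
     for v :: "(real^'n) \<times> (real^'n)"
  define B where "B w = ?y \<bullet> snd w - 1/2 * (?y \<bullet> (h (fst w) *v ?y))" for w :: "(real^'n) \<times> (real^'n)"
  define F where "F w = energy h w - B w" for w
  have o: "open (S \<times> (UNIV :: (real^'n) set))" using open_S by (simp add: open_Times)
  have zS: "z \<in> S \<times> UNIV" using z by (simp add: mem_Times_iff)
  have "(fst has_derivative fst) (at z)"
    by (simp add: bounded_linear_fst bounded_linear_imp_has_derivative)
  note hfst = has_derivative_compose[OF this h_has_derivative[OF z]]
  have B: "(B has_derivative L) (at z)"
    unfolding B_def L_def quadratic_form_sum
    by (intro has_derivative_diff has_derivative_mult_right has_derivative_sum hfst
        bounded_linear_imp_has_derivative bounded_linear_compose[OF bounded_linear_inner_right]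
        bounded_linear_snd)
  let ?E = "frechet_derivative (energy h) (at z)"
  have E: "(energy h has_derivative ?E) (at z)"
    by (rule twice_differentiable_onD(2)[OF energy_twice zS])
  have F: "(F has_derivative (\<lambda>v. ?E v - L v)) (at z)"
    unfolding F_def by (rule has_derivative_diff[OF E B])
  \<comment> \<open>the defect in Legendre duality is a square\<close>
  have F_sq: "F w = 1/2 * ((raise w - ?y) \<bullet> (h (fst w) *v (raise w - ?y)))" if w: "w \<in> S \<times> UNIV" for w
  proof -
    have w': "fst w \<in> S" using w by auto
    have "raise w \<bullet> (h (fst w) *v ?y) = snd w \<bullet> ?y"
      by (simp add: h_selfadjoint[OF w'] h_raise[OF w'])
    then show ?thesis
      by (simp add: F_def B_def energy_eq h_raise[OF w'] matrix_vector_mult_diff_distrib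
          inner_diff_left inner_diff_right inner_commute algebra_simps)
  qed
  have "F z \<le> F w" if "w \<in> S \<times> UNIV" for w
    using F_sq[OF that] F_sq[OF zS] h_pos[of "fst w" "raise w - ?y"] that
    by (cases "raise w = ?y") auto
  then have "eventually (\<lambda>w. F z \<le> F w) (at z)"
    using eventually_at_topological o zS by blast
  from has_derivative_local_min[OF F this] have "?E = L"
    by (metis (no_types, lifting) eq_iff_diff_eq_0 ext)
  with E show ?thesis unfolding L_def by simp
qed

lemma Gamma0_eq:
  assumes z: "fst z \<in> S"
  shows "Gamma0 h z i j = 1/2 * (\<Sum>l\<in>UNIV. raise z $ l *
     (partial i (\<lambda>y. h y $ j $ l) (fst z) + partial j (\<lambda>y. h y $ i $ l) (fst z)
      - partial l (\<lambda>y. h y $ i $ j) (fst z)))"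
proof -
  let ?X = "\<lambda>l. partial i (\<lambda>y. h y $ j $ l) (fst z) + partial j (\<lambda>y. h y $ i $ l) (fst z)
      - partial l (\<lambda>y. h y $ i $ j) (fst z)"
  have "Gamma0 h z i j = 1/2 * (\<Sum>k\<in>UNIV. \<Sum>l\<in>UNIV. snd z $ k * ginv h (fst z) k l * ?X l)"
    unfolding Gamma0_def christoffel_def by (simp add: sum_distrib_left mult_ac)
  also have "\<dots> = 1/2 * (\<Sum>l\<in>UNIV. g0 h z l * ?X l)"
    unfolding g0_def sum_distrib_right by (subst sum.swap) (rule refl)
  finally show ?thesis by (simp add: g0_eq_raise[OF z])
qed

lemma Gamma0_sym: "fst z \<in> S \<Longrightarrow> Gamma0 h z i j = Gamma0 h z j i"
  by (simp add: Gamma0_eq partial_h_sym[of _ _ i j] algebra_simps)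

definition vertical_part :: "(real^'n) \<times> (real^'n) \<Rightarrow> (real^'n) \<times> (real^'n) \<Rightarrow> real^'n" where
  "vertical_part z v = (\<chi> i. Dp h z i v)"

text \<open>This is \<open>dt = g\<^sup>0\<^sup>i Dp\<^sub>i\<close>: the energy is constant along the horizontal fields
  \<open>\<delta>/\<delta>q\<^sup>i\<close>. Contracting \<open>\<Gamma>\<^sup>0\<^sub>i\<^sub>k\<close> with \<open>y\<^sup>i\<close> leaves only \<open>1/2 y\<^sup>i y\<^sup>j \<partial>\<^sub>k g\<^sub>i\<^sub>j\<close>, because the two
  other terms of the Christoffel symbol cancel; this is the \<open>q\<close>-derivative of the energy up to
  sign.\<close>

lemma energy_derivative_frame:
  assumes z: "fst z \<in> S"
  shows "(energy h has_derivative (\<lambda>v. raise z \<bullet> vertical_part z v)) (at z)"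
proof -
  let ?y = "raise z" and ?P = "\<lambda>k i j. partial k (\<lambda>y. h y $ i $ j) (fst z)"
  have G: "(\<Sum>i\<in>UNIV. ?y $ i * Gamma0 h z i k) = 1/2 * (\<Sum>i\<in>UNIV. \<Sum>j\<in>UNIV. ?y $ i * ?y $ j * ?P k i j)" for k
  proof -
    have "(\<Sum>i\<in>UNIV. ?y $ i * Gamma0 h z i k)
      = 1/2 * ((\<Sum>i\<in>UNIV. \<Sum>j\<in>UNIV. ?y $ i * ?y $ j * ?P i k j) + (\<Sum>i\<in>UNIV. \<Sum>j\<in>UNIV. ?y $ i * ?y $ j * ?P k i j)
         - (\<Sum>i\<in>UNIV. \<Sum>j\<in>UNIV. ?y $ i * ?y $ j * ?P j i k))"
      unfolding Gamma0_eq[OF z]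
      by (simp add: sum_distrib_left algebra_simps sum.distrib sum_subtractf)
    also have "(\<Sum>i\<in>UNIV. \<Sum>j\<in>UNIV. ?y $ i * ?y $ j * ?P i k j) = (\<Sum>i\<in>UNIV. \<Sum>j\<in>UNIV. ?y $ i * ?y $ j * ?P j i k)"
      by (subst sum.swap) (simp add: partial_h_sym[OF z, of _ k] mult_ac)
    finally show ?thesis by simp
  qed
  have "?y \<bullet> vertical_part z v = ?y \<bullet> snd v - 1/2 * (\<Sum>i\<in>UNIV. \<Sum>j\<in>UNIV. ?y $ i * ?y $ j * (\<Sum>k\<in>UNIV. fst v $ k * ?P k i j))" for v
  proof -
    have "?y \<bullet> vertical_part z v = ?y \<bullet> snd v - (\<Sum>i\<in>UNIV. \<Sum>k\<in>UNIV. fst v $ k * (?y $ i * Gamma0 h z i k))"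
      by (simp add: vertical_part_def Dp_def dq_def inner_vec_def right_diff_distrib sum_subtractf sum_distrib_left mult_ac)
    also have "(\<Sum>i\<in>UNIV. \<Sum>k\<in>UNIV. fst v $ k * (?y $ i * Gamma0 h z i k))
        = (\<Sum>k\<in>UNIV. fst v $ k * (\<Sum>i\<in>UNIV. ?y $ i * Gamma0 h z i k))"
      by (subst sum.swap) (simp add: sum_distrib_left)
    also have "\<dots> = 1/2 * (\<Sum>k\<in>UNIV. \<Sum>i\<in>UNIV. \<Sum>j\<in>UNIV. ?y $ i * ?y $ j * (fst v $ k * ?P k i j))"
      unfolding G by (simp add: sum_distrib_left mult_ac)
    also have "(\<Sum>k\<in>UNIV. \<Sum>i\<in>UNIV. \<Sum>j\<in>UNIV. ?y $ i * ?y $ j * (fst v $ k * ?P k i j))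
        = (\<Sum>i\<in>UNIV. \<Sum>k\<in>UNIV. \<Sum>j\<in>UNIV. ?y $ i * ?y $ j * (fst v $ k * ?P k i j))"
      by (rule sum.swap)
    also have "\<dots> = (\<Sum>i\<in>UNIV. \<Sum>j\<in>UNIV. \<Sum>k\<in>UNIV. ?y $ i * ?y $ j * (fst v $ k * ?P k i j))"
      by (rule sum.cong[OF refl sum.swap])
    finally show ?thesis by (simp add: sum_distrib_left)
  qed
  with energy_has_derivative[OF z] show ?thesis by presburger
qed

text \<open>This is \<open>Dp\<^sub>i \<and> dq\<^sup>i = dp\<^sub>i \<and> dq\<^sup>i\<close>, by the symmetry of \<open>\<Gamma>\<^sup>0\<^sub>i\<^sub>j\<close>.\<close>

lemma vertical_part_wedge:
  assumes z: "fst z \<in> S"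
  shows "vertical_part z v \<bullet> fst w - vertical_part z w \<bullet> fst v = dp_wedge_dq v w"
proof -
  have *: "vertical_part z v \<bullet> fst w = snd v \<bullet> fst w - (\<Sum>i\<in>UNIV. \<Sum>j\<in>UNIV. Gamma0 h z i j * fst v $ j * fst w $ i)" for v w
    by (simp add: vertical_part_def Dp_def dq_def inner_vec_def left_diff_distrib right_diff_distrib
        sum_subtractf sum_distrib_left sum_distrib_right mult_ac)
  have "(\<Sum>i\<in>UNIV. \<Sum>j\<in>UNIV. Gamma0 h z i j * fst v $ j * fst w $ i)
      = (\<Sum>i\<in>UNIV. \<Sum>j\<in>UNIV. Gamma0 h z i j * fst w $ j * fst v $ i)"
    by (subst sum.swap) (simp add: Gamma0_sym[OF z] mult_ac)
  then show ?thesis by (simp add: * dp_wedge_dq_def)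
qed


end

section \<open>The fundamental form\<close>

text \<open>The coefficients of \<open>G\<close> and \<open>J\<close> with \<open>P = 2c - A\<^sup>2t\<lambda>\<^sup>2\<close>, \<open>Q = \<lambda> + 2t\<lambda>'\<close> and
  \<open>N = c - A\<^sup>2t\<lambda>(\<lambda> + t\<lambda>')\<close>. They say that the rank one parts in the two blocks of \<open>G(\<cdot>, J \<cdot>)\<close>
  have the coefficients \<open>\<mu>\<close> and \<open>-\<mu>\<close>; the factor \<open>2t\<close> is \<open>p\<^sub>i g\<^sup>0\<^sup>i\<close>.\<close>

lemma fundamental_coefficients:
  fixes A t l m P Q N :: real
  assumes nz: "A \<noteq> 0" "t \<noteq> 0" "l \<noteq> 0" "P \<noteq> 0" "Q \<noteq> 0" and N: "2 * N = P - A\<^sup>2 * t * l * Q"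
  shows "(1 / (A * t)) * (N / (A * t * Q)) + (- N + m * A\<^sup>2 * t\<^sup>2 * Q) / (A * t\<^sup>2 * P) * (A * t * l)
      + 2 * t * ((- N + m * A\<^sup>2 * t\<^sup>2 * Q) / (A * t\<^sup>2 * P)) * (N / (A * t * Q)) = m" (is ?A)
    and "A * t * l\<^sup>2 * (N / (A * t\<^sup>2 * l * P)) - (l * N + m * t * P) / (A * t * Q) * (1 / (A * t * l))
      + 2 * t * ((l * N + m * t * P) / (A * t * Q)) * (N / (A * t\<^sup>2 * l * P)) = - m" (is ?B)
proof -
  have P: "P = 2 * N + A\<^sup>2 * t * l * Q" using N by simp
  show ?A using nz by (simp add: divide_simps power2_eq_square) (simp add: P power2_eq_square algebra_simps)
  show ?B using nz by (simp add: divide_simps power2_eq_square) (simp add: P power2_eq_square algebra_simps)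
qed

context coordinate_metric
begin

lemma G_loc_eq:
  assumes z: "fst z \<in> S"
  shows "G_loc A c lam mu h z v w =
      coef_c1 A lam (energy h z) * (fst v \<bullet> (h (fst z) *v fst w))
    + coef_d1 A c lam mu (energy h z) * (snd z \<bullet> fst v) * (snd z \<bullet> fst w)
    + coef_c2 A (energy h z) * (vertical_part z v \<bullet> (matrix_inv (h (fst z)) *v vertical_part z w))
    + coef_d2 A c lam mu (energy h z) * (raise z \<bullet> vertical_part z v) * (raise z \<bullet> vertical_part z w)"
  unfolding G_loc_def Let_def
  by (simp add: g0_eq_raise[OF z] inner_vec_def matrix_vector_mult_def vertical_part_def dq_def ginv_def
      sum_distrib_left sum_product sum.distrib distrib_left distrib_right mult_ac)

lemma delta_q_nth: "fst (delta_q h z j) $ k = (if k = j then 1 else 0)" "snd (delta_q h z j) $ k = Gamma0 h z j k"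
  by (auto simp: delta_q_def axis_def)

lemma partial_p_nth: "fst (partial_p j) $ k = 0" "snd (partial_p j) $ k = (if k = j then 1 else 0)"
  by (auto simp: partial_p_def axis_def)

lemma J_loc_nth:
  shows "fst (J_loc A c lam h z v) $ k = - (\<Sum>i\<in>UNIV. Dp h z i v * J2 A c lam h z i k)"
    and "snd (J_loc A c lam h z v) $ k = (\<Sum>i\<in>UNIV. dq i v * J1 A c lam h z i k)
       - (\<Sum>i\<in>UNIV. \<Sum>j\<in>UNIV. Dp h z i v * (J2 A c lam h z i j * Gamma0 h z j k))"
  by (simp_all add: J_loc_def fst_sum snd_sum delta_q_nth partial_p_nth sum_negf sum_distrib_left
      if_distrib[of "\<lambda>x. _ * x"] cong: if_cong)

lemma fst_J_loc:
  assumes z: "fst z \<in> S"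
  defines "t \<equiv> energy h z"
  shows "fst (J_loc A c lam h z v) =
    - ((1 / (A * t * lam t)) *\<^sub>R (matrix_inv (h (fst z)) *v vertical_part z v)
      - ((c - A\<^sup>2 * t * lam t * (lam t + t * deriv lam t)) / (A * t\<^sup>2 * lam t * (2 * c - A\<^sup>2 * t * (lam t)\<^sup>2))
          * (raise z \<bullet> vertical_part z v)) *\<^sub>R raise z)"
  (is "_ = - (?a *\<^sub>R _ - (?b * _) *\<^sub>R _)")
proof (rule vec_eq_iff[THEN iffD2], rule allI)
  fix k
  define a b where ab: "a = ?a" "b = ?b"
  have "J2 A c lam h z i k = a * ginv h (fst z) k i - b * raise z $ i * raise z $ k" for i
    unfolding J2_def Let_def t_def[symmetric] ab ginv_sym[OF z, of i k] g0_eq_raise[OF z] ..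
  then show "fst (J_loc A c lam h z v) $ k = (- (?a *\<^sub>R (matrix_inv (h (fst z)) *v vertical_part z v)
      - (?b * (raise z \<bullet> vertical_part z v)) *\<^sub>R raise z)) $ k"
    unfolding J_loc_nth ab[symmetric]
    by (simp add: ginv_def matrix_vector_mult_def inner_vec_def vertical_part_def sum_distrib_left
       sum_distrib_right right_diff_distrib sum_subtractf mult_ac)
qed

lemma vertical_part_J_loc:
  assumes z: "fst z \<in> S"
  defines "t \<equiv> energy h z"
  shows "vertical_part z (J_loc A c lam h z v) = (A * t * lam t) *\<^sub>R (h (fst z) *v fst v)
      + ((c - A\<^sup>2 * t * lam t * (lam t + t * deriv lam t)) / (A * t * (lam t + 2 * t * deriv lam t))
         * (snd z \<bullet> fst v)) *\<^sub>R snd z"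
  (is "_ = ?a *\<^sub>R _ + (?b * _) *\<^sub>R _")
proof (rule vec_eq_iff[THEN iffD2], rule allI)
  fix k
  let ?J = "J_loc A c lam h z v"
  have "(\<Sum>j\<in>UNIV. Gamma0 h z k j * fst ?J $ j)
      = - (\<Sum>i\<in>UNIV. \<Sum>j\<in>UNIV. Dp h z i v * (J2 A c lam h z i j * Gamma0 h z j k))"
    unfolding J_loc_nth
    by (simp add: sum_negf sum_distrib_left) (subst sum.swap, simp add: Gamma0_sym[OF z, of k] mult_ac)
  then have "vertical_part z ?J $ k = (\<Sum>i\<in>UNIV. dq i v * J1 A c lam h z i k)"
    by (simp add: vertical_part_def Dp_def[of _ _ _ ?J] dq_def[of _ ?J] J_loc_nth(2))
  moreover define a b where ab: "a = ?a" "b = ?b"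
  moreover have "J1 A c lam h z i k = a * h (fst z) $ k $ i + b * snd z $ i * snd z $ k" for i
    unfolding J1_def Let_def t_def[symmetric] ab h_sym[OF z, of i k] ..
  ultimately show "vertical_part z ?J $ k = (?a *\<^sub>R (h (fst z) *v fst v)
      + (?b * (snd z \<bullet> fst v)) *\<^sub>R snd z) $ k"
    unfolding ab[symmetric]
    by (simp add: dq_def matrix_vector_mult_def inner_vec_def sum_distrib_left sum_distrib_right
       distrib_left sum.distrib mult_ac)
qed

text \<open>The two off-diagonal blocks of \<open>G(\<cdot>, J \<cdot>)\<close> are products of matrices of the form
  \<open>a g + b p p\<close> and \<open>a g\<^sup>-\<^sup>1 + b y y\<close>, hence again a multiple of the identity plus one of
  \<open>p y\<close>. By \<open>fundamental_coefficients\<close> the result is \<open>\<phi> = \<lambda> d\<Theta> + \<mu> dt \<and> \<Theta>\<close>.\<close>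

lemma fundamental_form_eq:
  assumes z: "fst z \<in> S" "snd z \<noteq> 0" and A: "A > 0"
    and lam: "\<And>t. t > 0 \<Longrightarrow> lam t > 0"
    and pos: "\<And>t. t > 0 \<Longrightarrow> (2 * c - A\<^sup>2 * t * (lam t)\<^sup>2) / (lam t + 2 * t * deriv lam t) > 0"
  shows "G_loc A c lam mu h z v (J_loc A c lam h z w) = lam (energy h z) * dp_wedge_dq v w
     + mu (energy h z) * ((raise z \<bullet> vertical_part z v) * (snd z \<bullet> fst w) - (raise z \<bullet> vertical_part z w) * (snd z \<bullet> fst v))"
proof -
  define t where "t = energy h z"
  define l where "l = lam t"
  define P where "P = 2 * c - A\<^sup>2 * t * l\<^sup>2"
  define Q where "Q = l + 2 * t * deriv lam t"
  define N where "N = c - A\<^sup>2 * t * l * (l + t * deriv lam t)"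
  define m where "m = mu t"
  have t: "t > 0" unfolding t_def by (rule energy_pos[OF z])
  have l: "l > 0" unfolding l_def by (rule lam[OF t])
  have "P / Q > 0" unfolding P_def Q_def l_def by (rule pos[OF t])
  then have PQ: "P \<noteq> 0" "Q \<noteq> 0" by auto
  have N: "2 * N = P - A\<^sup>2 * t * l * Q" by (simp add: P_def Q_def N_def power2_eq_square algebra_simps)
  define c1 c2 d1 d2 where cd: "c1 = A * t * l\<^sup>2" "c2 = 1 / (A * t)" "d1 = (l * N + m * t * P) / (A * t * Q)"
    "d2 = (- N + m * A\<^sup>2 * t\<^sup>2 * Q) / (A * t\<^sup>2 * P)"
  have coef: "coef_c1 A lam t = c1" "coef_c2 A t = c2" "coef_d1 A c lam mu t = d1" "coef_d2 A c lam mu t = d2"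
    by (simp_all add: coef_c1_def coef_c2_def coef_d1_def coef_d2_def cd Let_def m_def N_def P_def Q_def
        flip: l_def)
  define a1 b1 a2 b2 where ab: "a1 = A * t * l" "b1 = N / (A * t * Q)" "a2 = 1 / (A * t * l)" "b2 = N / (A * t\<^sup>2 * l * P)"
  have nz: "A \<noteq> 0" "t \<noteq> 0" "l \<noteq> 0" using A t l by auto
  have k: "c2 * a1 = l" "c1 * a2 = l" using nz by (simp_all add: cd ab power2_eq_square)
  have k2: "c2 * b1 + d2 * a1 + 2 * t * d2 * b1 = m" "c1 * b2 - d1 * a2 + 2 * t * d1 * b2 = - m"
    unfolding cd ab by (rule fundamental_coefficients[OF nz PQ N])+
  let ?H = "matrix_inv (h (fst z))"
  define \<beta> \<beta>' y p where v: "\<beta> = vertical_part z v" "\<beta>' = vertical_part z w" "y = raise z" "p = snd z"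
  have J: "fst (J_loc A c lam h z w) = - (a2 *\<^sub>R (?H *v \<beta>') - (b2 * (y \<bullet> \<beta>')) *\<^sub>R y)"
     "vertical_part z (J_loc A c lam h z w) = a1 *\<^sub>R (h (fst z) *v fst w) + (b1 * (p \<bullet> fst w)) *\<^sub>R p"
    unfolding fst_J_loc[OF z(1)] vertical_part_J_loc[OF z(1)]
    by (simp_all add: ab v N_def P_def Q_def flip: t_def l_def)
  have py: "p \<bullet> y = 2 * t" by (simp add: t_def energy_eq v)
  have Hp: "?H *v p = y" by (simp add: v raise_def)
  have hy: "h (fst z) *v y = p" using h_raise[OF z(1)] by (simp add: v)
  have pH: "p \<bullet> (?H *v a) = y \<bullet> a" for a
    using h_selfadjoint[OF z(1), of y "?H *v a"] by (simp add: h_mult_ginv[OF z(1)] hy)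
  have yh: "y \<bullet> (h (fst z) *v a) = p \<bullet> a" for a
    using h_selfadjoint[OF z(1), of y a] by (simp add: hy)
  have 1: "fst v \<bullet> (h (fst z) *v fst (J_loc A c lam h z w)) = - a2 * (\<beta>' \<bullet> fst v) + b2 * (y \<bullet> \<beta>') * (p \<bullet> fst v)"
    unfolding J by (simp add: matrix_vector_mult_diff_distrib matrix_vector_mult_scaleR vec.neg
        h_mult_ginv[OF z(1)] hy inner_diff_right inner_commute)
  have 2: "p \<bullet> fst (J_loc A c lam h z w) = - a2 * (y \<bullet> \<beta>') + 2 * t * b2 * (y \<bullet> \<beta>')"
    unfolding J by (simp add: inner_diff_right pH py)
  have 3: "\<beta> \<bullet> (?H *v vertical_part z (J_loc A c lam h z w)) = a1 * (\<beta> \<bullet> fst w) + b1 * (p \<bullet> fst w) * (y \<bullet> \<beta>)"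
    unfolding J by (simp add: matrix_vector_right_distrib matrix_vector_mult_scaleR
        h_mult_ginv[OF z(1)] Hp inner_add_right inner_commute)
  have 4: "y \<bullet> vertical_part z (J_loc A c lam h z w) = a1 * (p \<bullet> fst w) + 2 * t * b1 * (p \<bullet> fst w)"
    unfolding J using py by (simp add: inner_add_right yh inner_commute)
  have "G_loc A c lam mu h z v (J_loc A c lam h z w)
     = c1 * (- a2 * (\<beta>' \<bullet> fst v) + b2 * (y \<bullet> \<beta>') * (p \<bullet> fst v))
     + d1 * (p \<bullet> fst v) * (- a2 * (y \<bullet> \<beta>') + 2 * t * b2 * (y \<bullet> \<beta>'))
     + c2 * (a1 * (\<beta> \<bullet> fst w) + b1 * (p \<bullet> fst w) * (y \<bullet> \<beta>))
     + d2 * (y \<bullet> \<beta>) * (a1 * (p \<bullet> fst w) + 2 * t * b1 * (p \<bullet> fst w))"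
    unfolding G_loc_eq[OF z(1)] t_def[symmetric] coef v(1,3,4)[symmetric] 1 2 3 4 ..
  also have "\<dots> = (c2 * a1) * (\<beta> \<bullet> fst w) - (c1 * a2) * (\<beta>' \<bullet> fst v)
     + (c2 * b1 + d2 * a1 + 2 * t * d2 * b1) * ((y \<bullet> \<beta>) * (p \<bullet> fst w))
     + (c1 * b2 - d1 * a2 + 2 * t * d1 * b2) * ((y \<bullet> \<beta>') * (p \<bullet> fst v))"
    by (simp add: algebra_simps)
  also have "\<dots> = l * (\<beta> \<bullet> fst w - \<beta>' \<bullet> fst v) + m * ((y \<bullet> \<beta>) * (p \<bullet> fst w) - (y \<bullet> \<beta>') * (p \<bullet> fst v))"
    unfolding k k2 by (simp add: algebra_simps)
  finally show ?thesis unfolding v vertical_part_wedge[OF z(1)] l_def m_def t_def .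
qed

section \<open>Its exterior derivative\<close>

text \<open>The computation \<open>d(\<lambda> d\<Theta> + \<mu> dt \<and> \<Theta>) = \<lambda>' dt \<and> d\<Theta> - \<mu> dt \<and> d\<Theta>\<close>. The terms
  with \<open>\<mu>'\<close> cancel because \<open>dt \<and> dt = 0\<close>, those with second derivatives of the energy because
  \<open>d dt = 0\<close>, that is, by the symmetry of second derivatives.\<close>

lemma ext_deriv2_fundamental:
  assumes z: "fst z \<in> S" "snd z \<noteq> 0"
    and \<phi>: "\<And>x v w. fst x \<in> S \<Longrightarrow> snd x \<noteq> 0 \<Longrightarrow> \<phi> x v w = lam (energy h x) * dp_wedge_dq v w
     + mu (energy h x) * ((raise x \<bullet> vertical_part x v) * (snd x \<bullet> fst w) - (raise x \<bullet> vertical_part x w) * (snd x \<bullet> fst v))"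
    and lam: "lam differentiable (at (energy h z))" and mu: "mu differentiable (at (energy h z))"
  shows "ext_deriv2 \<phi> z u v w = (deriv lam (energy h z) - mu (energy h z)) *
     ((raise z \<bullet> vertical_part z u) * dp_wedge_dq v w + (raise z \<bullet> vertical_part z v) * dp_wedge_dq w u + (raise z \<bullet> vertical_part z w) * dp_wedge_dq u v)"
proof -
  define T where "T = S \<times> - {0 :: real^'n}"
  have T: "open T" "z \<in> T" using open_S z by (auto simp: T_def mem_Times_iff intro: open_Times)
  let ?E = "energy h"
  let ?D = "\<lambda>x v. frechet_derivative ?E (at x) v"
  let ?D2 = "\<lambda>a b. frechet_derivative (\<lambda>x. ?D x a) (at z) b"
  have D: "raise x \<bullet> vertical_part x v = ?D x v" if "x \<in> T" for x v
    using frechet_derivative_at[OF energy_derivative_frame[of x]] that by (simp add: T_def mem_Times_iff)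
      (metis)
  have zS: "z \<in> S \<times> UNIV" using z by (simp add: mem_Times_iff)
  have oS: "open (S \<times> (UNIV :: (real^'n) set))" using open_S by (simp add: open_Times)
  note E = twice_differentiable_onD[OF energy_twice zS]
  have sym: "?D2 a b = ?D2 b a" for a b
    by (rule second_derivative_symmetric[OF oS zS twice_differentiable_onD(1)[OF energy_twice] E(3) E(3)])
  have comp: "((\<lambda>x. f (?E x)) has_derivative (\<lambda>a. deriv f (?E z) * ?D z a)) (at z)"
    if "f differentiable (at (?E z))" for f :: "real \<Rightarrow> real"
    using has_derivative_compose[OF E(2), of f] that
    by (simp add: DERIV_deriv_iff_real_differentiable[symmetric] has_field_derivative_def)
  have th: "((\<lambda>x. snd x \<bullet> a) has_derivative (\<lambda>b. snd b \<bullet> a)) (at z)" for a :: "real^'n"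
    by (intro bounded_linear_imp_has_derivative bounded_linear_compose[OF bounded_linear_inner_left]
        bounded_linear_snd)
  have der: "frechet_derivative (\<lambda>x. \<phi> x v w) (at z) u =
      deriv lam (?E z) * ?D z u * dp_wedge_dq v w
    + deriv mu (?E z) * ?D z u * (?D z v * (snd z \<bullet> fst w) - ?D z w * (snd z \<bullet> fst v))
    + mu (?E z) * (?D2 v u * (snd z \<bullet> fst w) + ?D z v * (snd u \<bullet> fst w)
                 - ?D2 w u * (snd z \<bullet> fst v) - ?D z w * (snd u \<bullet> fst v))" for u v w
  proof -
    have E2: "((\<lambda>x. ?D x a) has_derivative ?D2 a) (at z)" for a
      using E(3)[of a] by (simp add: frechet_derivative_works)
    have "((\<lambda>x. lam (?E x) * dp_wedge_dq v w + mu (?E x) * (?D x v * (snd x \<bullet> fst w) - ?D x w * (snd x \<bullet> fst v)))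
       has_derivative (\<lambda>u. deriv lam (?E z) * ?D z u * dp_wedge_dq v w
    + deriv mu (?E z) * ?D z u * (?D z v * (snd z \<bullet> fst w) - ?D z w * (snd z \<bullet> fst v))
    + mu (?E z) * (?D2 v u * (snd z \<bullet> fst w) + ?D z v * (snd u \<bullet> fst w)
                 - ?D2 w u * (snd z \<bullet> fst v) - ?D z w * (snd u \<bullet> fst v)))) (at z)"
      by (rule derivative_eq_intros comp[OF lam] comp[OF mu] E2 th refl)+ (simp add: algebra_simps fun_eq_iff)
    then have "((\<lambda>x. \<phi> x v w) has_derivative (\<lambda>u. deriv lam (?E z) * ?D z u * dp_wedge_dq v w
    + deriv mu (?E z) * ?D z u * (?D z v * (snd z \<bullet> fst w) - ?D z w * (snd z \<bullet> fst v))
    + mu (?E z) * (?D2 v u * (snd z \<bullet> fst w) + ?D z v * (snd u \<bullet> fst w)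
                 - ?D2 w u * (snd z \<bullet> fst v) - ?D z w * (snd u \<bullet> fst v)))) (at z)"
      by (rule has_derivative_transform_within_open[OF _ T])
        (use D in \<open>simp add: \<phi> T_def mem_Times_iff\<close>)
    from frechet_derivative_at[OF this, symmetric] show ?thesis by simp
  qed
  show ?thesis
    unfolding ext_deriv2_def der D[OF T(2)] sym[of u v] sym[of u w] sym[of v w] dp_wedge_dq_def
    by (simp add: algebra_simps)
qed

text \<open>The form \<open>dt \<and> d\<Theta>\<close> vanishes nowhere off the zero section. Along the fibre \<open>dt\<close> has a
  kernel of dimension \<open>n - 1 > 0\<close>; a vertical vector \<open>b\<close> in it, the radial vector \<open>p\<close> and the
  \<open>q\<close>-direction \<open>b\<close> give the value \<open>2t |b|\<^sup>2\<close>.\<close>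

lemma ext_deriv2_witness:
  assumes n: "CARD('n) > 1" and z: "fst z \<in> S" "snd z \<noteq> 0"
  obtains u v w where "(raise z \<bullet> vertical_part z u) * dp_wedge_dq v w + (raise z \<bullet> vertical_part z v) * dp_wedge_dq w u
     + (raise z \<bullet> vertical_part z w) * dp_wedge_dq u v \<noteq> 0"
proof -
  obtain b :: "real^'n" where b: "b \<noteq> 0" "orthogonal (raise z) b"
    by (rule orthogonal_to_vector_exists[of "raise z"]) (use n in auto)
  let ?u = "(0, snd z)" and ?v = "(0, b)" and ?w = "(b, 0)"
  have "vertical_part z ?u = snd z" "vertical_part z ?v = b"
    by (simp_all add: vertical_part_def Dp_def dq_def)
  then have "(raise z \<bullet> vertical_part z ?u) * dp_wedge_dq ?v ?w + (raise z \<bullet> vertical_part z ?v) * dp_wedge_dq ?w ?u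
     + (raise z \<bullet> vertical_part z ?w) * dp_wedge_dq ?u ?v = (snd z \<bullet> raise z) * (b \<bullet> b)"
    using b by (simp add: dp_wedge_dq_def orthogonal_def inner_commute)
  moreover have "snd z \<bullet> raise z > 0" using energy_pos[OF z] by (simp add: energy_eq)
  ultimately show ?thesis using b that[of ?u ?v ?w] by simp
qed

end

section \<open>Tangent and cotangent vectors in coordinates\<close>

lemma smooth_on_imp_differentiable: "smooth_on S f \<Longrightarrow> x \<in> S \<Longrightarrow> f differentiable (at x)"
proof -
  assume "smooth_on S f" and x: "x \<in> S"
  then have "Ck_on (Suc 0) S f" by (simp only: smooth_on_def)
  with x show ?thesis by simp
qed

lemma chart_inv_apply:
  assumes "is_chart C" "m \<in> chart_dom C" shows "chart_inv C (snd C m) = m"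
  using assms unfolding is_chart_def by (metis homeomorphism_apply1)

lemma open_chart_image:
  assumes "is_chart C" "open W" "W \<subseteq> chart_dom C" shows "open (snd C ` W)"
proof -
  have h: "homeomorphism (chart_dom C) (chart_image C) (snd C) (chart_inv C)" "open (chart_image C)"
    using assms(1) by (auto simp: is_chart_def)
  have "openin (top_of_set (chart_dom C)) W"
    using assms(2,3) by (simp add: open_subset)
  then have "openin (top_of_set (chart_image C)) (snd C ` W)"
    by (rule homeomorphism_imp_open_map[OF h(1)])
  then show ?thesis using h(2) openin_open_eq by blast
qed

locale atlas =
  fixes \<A> :: "('m::{t2_space, second_countable_topology}, 'n::finite) chart set"
  assumes smooth_atlas: "smooth_atlas \<A>"
begin

lemma chart: "C \<in> \<A> \<Longrightarrow> is_chart C"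
  using smooth_atlas by (simp add: smooth_atlas_def)

lemma open_chart_dom: "C \<in> \<A> \<Longrightarrow> open (chart_dom C)"
  using chart by (simp add: is_chart_def)

lemma ex_chart: obtains C where "C \<in> \<A>" "m \<in> chart_dom C"
  using smooth_atlas unfolding smooth_atlas_def by blast

abbreviation jac :: "('m, 'n) chart \<Rightarrow> ('m, 'n) chart \<Rightarrow> 'm \<Rightarrow> real^'n \<Rightarrow> real^'n" where
  "jac C C' m \<equiv> frechet_derivative (transition C C') (at (snd C m))"

lemma transition_apply: "C \<in> \<A> \<Longrightarrow> m \<in> chart_dom C \<Longrightarrow> transition C C' (snd C m) = snd C' m"
  by (simp add: transition_def chart_inv_apply chart)

lemma transition_has_derivative:
  assumes "C \<in> \<A>" "C' \<in> \<A>" "m \<in> chart_dom C" "m \<in> chart_dom C'"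
  shows "(transition C C' has_derivative jac C C' m) (at (snd C m))"
proof -
  have "smooth_on (snd C ` (chart_dom C \<inter> chart_dom C')) (transition C C')"
    using smooth_atlas assms by (simp add: smooth_atlas_def)
  then have "transition C C' differentiable (at (snd C m))"
    by (rule smooth_on_imp_differentiable) (use assms in auto)
  then show ?thesis by (simp add: frechet_derivative_works)
qed

lemma linear_jac:
  assumes "C \<in> \<A>" "C' \<in> \<A>" "m \<in> chart_dom C" "m \<in> chart_dom C'"
  shows "linear (jac C C' m)"
  by (rule has_derivative_linear[OF transition_has_derivative[OF assms]])

lemma jac_self:
  assumes "C \<in> \<A>" "m \<in> chart_dom C" shows "jac C C m a = a"
proof -
  have "open (chart_image C)" using chart[OF assms(1)] by (simp add: is_chart_def)
  then have "(transition C C has_derivative (\<lambda>a. a)) (at (snd C m))"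
    by (rule has_derivative_transform_within_open[OF has_derivative_ident])
       (use assms in \<open>auto simp: transition_apply[OF assms(1)]\<close>)
  from frechet_derivative_at[OF this] show ?thesis by metis
qed

lemma jac_cocycle:
  assumes "C \<in> \<A>" "C' \<in> \<A>" "C'' \<in> \<A>" "m \<in> chart_dom C" "m \<in> chart_dom C'" "m \<in> chart_dom C''"
  shows "jac C' C'' m (jac C C' m a) = jac C C'' m a"
proof -
  let ?W = "chart_dom C \<inter> chart_dom C' \<inter> chart_dom C''"
  have "(transition C' C'' has_derivative jac C' C'' m) (at (transition C C' (snd C m)))"
    using transition_has_derivative[of C' C'' m] assms by (simp add: transition_apply)
  from has_derivative_compose[OF transition_has_derivative[of C C' m] this] assms
  have "((\<lambda>x. transition C' C'' (transition C C' x)) has_derivative (\<lambda>a. jac C' C'' m (jac C C' m a))) (at (snd C m))"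
    by simp
  moreover have "open (snd C ` ?W)"
    using assms by (intro open_chart_image[OF chart] open_Int open_chart_dom) auto
  ultimately have "(transition C C'' has_derivative (\<lambda>a. jac C' C'' m (jac C C' m a))) (at (snd C m))"
    by (rule has_derivative_transform_within_open) (use assms in \<open>auto simp: transition_apply\<close>)
  from frechet_derivative_at[OF this] show ?thesis by metis
qed

text \<open>The tangent vector at \<open>m\<close> whose components in the chart \<open>C\<close> are \<open>a\<close>. By the
  cocycle rule it obeys the transformation law, so \<open>a \<mapsto> tangent_vec C m a\<close> identifies
  \<open>\<real>\<^sup>n\<close> with the tangent space.\<close>

definition tangent_vec :: "('m, 'n) chart \<Rightarrow> 'm \<Rightarrow> real^'n \<Rightarrow> ('m, 'n) tvec" where
  "tangent_vec C m a = (\<lambda>C'. if C' \<in> \<A> \<and> m \<in> chart_dom C' then jac C C' m a else 0)"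

lemma coord_vec_eq: "coord_vec \<A> C m i = tangent_vec C m (axis i 1)"
  by (simp add: coord_vec_def tangent_vec_def)

lemma tangent_vec_apply: "C \<in> \<A> \<Longrightarrow> m \<in> chart_dom C \<Longrightarrow> tangent_vec C m a C = a"
  by (simp add: tangent_vec_def jac_self)

lemma tangent_vec_in: "C \<in> \<A> \<Longrightarrow> m \<in> chart_dom C \<Longrightarrow> tangent_vec C m a \<in> tangent_space \<A> m"
  by (simp add: tangent_space_def tangent_vec_def jac_cocycle)

lemma tangent_vec_components:
  assumes "C \<in> \<A>" "m \<in> chart_dom C" "v \<in> tangent_space \<A> m"
  shows "tangent_vec C m (v C) = v"
proof
  fix C'
  show "tangent_vec C m (v C) C' = v C'"
  proof (cases "C' \<in> \<A> \<and> m \<in> chart_dom C'")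
    case True
    then have "v C' = jac C C' m (v C)" using assms unfolding tangent_space_def by blast
    with True show ?thesis by (simp add: tangent_vec_def)
  next
    case False
    then have "v C' = 0" using assms(3) unfolding tangent_space_def by blast
    with False show ?thesis by (auto simp: tangent_vec_def)
  qed
qed

lemma tangent_vec_combo:
  assumes "C \<in> \<A>" "m \<in> chart_dom C"
  shows "tangent_vec C m (x *\<^sub>R a + y *\<^sub>R b) = (\<lambda>C'. x *\<^sub>R tangent_vec C m a C' + y *\<^sub>R tangent_vec C m b C')"
  using linear_jac[OF assms(1) _ assms(2)]
  by (auto simp: tangent_vec_def fun_eq_iff linear_add linear_scale)

lemma tangent_space_combo:
  assumes "v \<in> tangent_space \<A> m" "w \<in> tangent_space \<A> m"
  shows "(\<lambda>C. x *\<^sub>R v C + y *\<^sub>R w C) \<in> tangent_space \<A> m"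
proof -
  obtain C where C: "C \<in> \<A>" "m \<in> chart_dom C" by (rule ex_chart)
  show ?thesis
    using tangent_vec_in[OF C, of "x *\<^sub>R v C + y *\<^sub>R w C"]
    by (simp add: tangent_vec_combo[OF C] tangent_vec_components[OF C] assms)
qed

text \<open>Used both for covectors and for either argument of the metric.\<close>

lemma functional_on_tangent_vec:
  fixes L :: "('m, 'n) tvec \<Rightarrow> real"
  assumes C: "C \<in> \<A>" "m \<in> chart_dom C"
    and L: "\<And>v w a b. v \<in> tangent_space \<A> m \<Longrightarrow> w \<in> tangent_space \<A> m \<Longrightarrow>
        L (\<lambda>C. a *\<^sub>R v C + b *\<^sub>R w C) = a * L v + b * L w"
  shows "L (tangent_vec C m a) = (\<Sum>i\<in>UNIV. a $ i * L (coord_vec \<A> C m i))"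
proof -
  have combo: "L (tangent_vec C m (x *\<^sub>R a + y *\<^sub>R b)) = x * L (tangent_vec C m a) + y * L (tangent_vec C m b)" for x y a b
    by (simp add: tangent_vec_combo[OF C] L tangent_vec_in[OF C])
  have lin: "linear (\<lambda>a. L (tangent_vec C m a))"
    using combo[of 1 _ 1] combo[of _ _ 0] by (intro linearI) simp_all
  have "a = (\<Sum>i\<in>UNIV. a $ i *\<^sub>R axis i 1)"
    by (simp add: basis_expansion flip: scalar_mult_eq_scaleR)
  then have "L (tangent_vec C m a) = L (tangent_vec C m (\<Sum>i\<in>UNIV. a $ i *\<^sub>R axis i 1))"
    by (rule arg_cong)
  also have "\<dots> = (\<Sum>i\<in>UNIV. a $ i * L (tangent_vec C m (axis i 1)))"
    by (simp add: linear_sum[OF lin, unfolded o_def] linear_scale[OF lin])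
  finally show ?thesis by (simp add: coord_vec_eq)
qed

lemma metric_in_coordinates:
  assumes g: "riemannian_metric \<A> g" and C: "C \<in> \<A>" "m \<in> chart_dom C"
  shows "g m (tangent_vec C m a) (tangent_vec C m b) = a \<bullet> (metric_comp \<A> g C (snd C m) *v b)"
proof -
  have g1: "g m (\<lambda>C. x *\<^sub>R u C + y *\<^sub>R v C) w = x * g m u w + y * g m v w" and gs: "g m u w = g m w u"
    if "u \<in> tangent_space \<A> m" "v \<in> tangent_space \<A> m" "w \<in> tangent_space \<A> m" for u v w x y
    using g that unfolding riemannian_metric_def by blast+
  note T = tangent_vec_in[OF C]
  have cv: "coord_vec \<A> C m i \<in> tangent_space \<A> m" for i by (simp add: coord_vec_eq T)
  have g2: "g m w (\<lambda>C. x *\<^sub>R u C + y *\<^sub>R v C) = x * g m w u + y * g m w v"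
    if "u \<in> tangent_space \<A> m" "v \<in> tangent_space \<A> m" "w \<in> tangent_space \<A> m" for u v w x y
    using g1[OF that] gs that tangent_space_combo[OF that(1,2)] by metis
  have "g m (tangent_vec C m a) (tangent_vec C m b)
      = (\<Sum>i\<in>UNIV. a $ i * g m (coord_vec \<A> C m i) (tangent_vec C m b))"
    by (rule functional_on_tangent_vec[OF C]) (rule g1[OF _ _ T])
  also have "\<dots> = (\<Sum>i\<in>UNIV. a $ i * (\<Sum>j\<in>UNIV. b $ j * g m (coord_vec \<A> C m i) (coord_vec \<A> C m j)))"
    by (intro sum.cong refl arg_cong2[of _ _ _ _ "(*)"] functional_on_tangent_vec[OF C] g2[OF _ _ cv])
  finally show ?thesis
    by (simp add: metric_comp_def chart_inv_apply[OF chart[OF C(1)] C(2)] inner_vec_def matrix_vector_mult_def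
       sum_distrib_left mult_ac)
qed

lemma coordinate_metric:
  assumes g: "riemannian_metric \<A> g" and C: "C \<in> \<A>"
  shows "coordinate_metric (metric_comp \<A> g C) (chart_image C)"
proof
  show "open (chart_image C)" using chart[OF C] by (simp add: is_chart_def)
  show "twice_differentiable_on (chart_image C) (\<lambda>x. metric_comp \<A> g C x $ i $ j)" for i j
    using g C by (intro smooth_imp_twice_differentiable_on) (simp add: riemannian_metric_def)
next
  fix x i j assume "x \<in> chart_image C"
  then obtain m where m: "m \<in> chart_dom C" "x = snd C m" by auto
  have "coord_vec \<A> C m i \<in> tangent_space \<A> m" for i by (simp add: coord_vec_eq tangent_vec_in[OF C m(1)])
  then have "g m (coord_vec \<A> C m i) (coord_vec \<A> C m j) = g m (coord_vec \<A> C m j) (coord_vec \<A> C m i)"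
    using g unfolding riemannian_metric_def by blast
  then show "metric_comp \<A> g C x $ i $ j = metric_comp \<A> g C x $ j $ i"
    by (simp add: metric_comp_def m chart_inv_apply[OF chart[OF C]])
next
  fix x and a :: "real^'n" assume "x \<in> chart_image C" and a: "a \<noteq> 0"
  then obtain m where m: "m \<in> chart_dom C" "x = snd C m" by auto
  have "tangent_vec C m a \<noteq> (\<lambda>C. 0)"
    using tangent_vec_apply[OF C m(1), of a] a by auto
  then have "g m (tangent_vec C m a) (tangent_vec C m a) > 0"
    using g tangent_vec_in[OF C m(1)] unfolding riemannian_metric_def by blast
  then show "a \<bullet> (metric_comp \<A> g C x *v a) > 0"
    by (simp add: metric_in_coordinates[OF g C m(1)] m(2))
qed

text \<open>A covector that vanishes on the coordinate vectors vanishes on the whole tangent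
  space, which they span.\<close>

lemma cotangent_coords_nonzero:
  assumes C: "C \<in> \<A>" and P: "P \<in> cotangent_bundle0 \<A>" "fst P \<in> chart_dom C"
  shows "fst (cotangent_coords \<A> C P) \<in> chart_image C" "snd (cotangent_coords \<A> C P) \<noteq> 0"
proof -
  obtain m p where mp: "P = (m, p)" by (cases P)
  have m: "m \<in> chart_dom C" and p: "p \<in> cotangent_space \<A> m" "p \<noteq> (\<lambda>v. 0)"
    using P by (auto simp: mp cotangent_bundle0_def cotangent_bundle_def)
  show "fst (cotangent_coords \<A> C P) \<in> chart_image C" using P by (simp add: cotangent_coords_def)
  show "snd (cotangent_coords \<A> C P) \<noteq> 0"
  proof
    assume "snd (cotangent_coords \<A> C P) = 0"
    then have z: "p (coord_vec \<A> C m i) = 0" for i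
      by (simp add: cotangent_coords_def mp vec_eq_iff)
    have "p (tangent_vec C m a) = (\<Sum>i\<in>UNIV. a $ i * p (coord_vec \<A> C m i))" for a
      by (rule functional_on_tangent_vec[OF C m]) (use p(1) in \<open>simp add: cotangent_space_def\<close>)
    then have "p (tangent_vec C m a) = 0" for a by (simp add: z)
    then have "p v = 0" for v
      using p(1) tangent_vec_components[OF C m, of v] unfolding cotangent_space_def
      by (cases "v \<in> tangent_space \<A> m") (simp, metis, simp)
    with p(2) show False by auto
  qed
qed

lemma cotangent_coords_surj:
  assumes C: "C \<in> \<A>" "m \<in> chart_dom C" and \<xi>: "\<xi> \<noteq> 0"
  obtains P where "P \<in> cotangent_bundle0 \<A>" "fst P \<in> chart_dom C" "cotangent_coords \<A> C P = (snd C m, \<xi>)"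
proof
  define p where "p v = (if v \<in> tangent_space \<A> m then \<xi> \<bullet> v C else 0)" for v :: "('m, 'n) tvec"
  have pt: "p (tangent_vec C m a) = \<xi> \<bullet> a" for a
    by (simp add: p_def tangent_vec_in[OF C] tangent_vec_apply[OF C])
  have "p \<in> cotangent_space \<A> m"
    by (simp add: cotangent_space_def p_def tangent_space_combo inner_add_right)
  moreover have "p \<noteq> (\<lambda>v. 0)" using pt[of \<xi>] \<xi> by auto
  ultimately show "(m, p) \<in> cotangent_bundle0 \<A>"
    by (simp add: cotangent_bundle0_def cotangent_bundle_def)
  show "fst (m, p) \<in> chart_dom C" using C by simp
  show "cotangent_coords \<A> C (m, p) = (snd C m, \<xi>)"
    by (simp add: cotangent_coords_def coord_vec_eq pt inner_axis vec_eq_iff)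
qed

end

section \<open>The Kaehler condition\<close>

theorem theorem7:
  fixes \<A> :: "('m::{t2_space, second_countable_topology}, 'n::finite) chart set"
    and g :: "'m \<Rightarrow> ('m, 'n) tvec \<Rightarrow> ('m, 'n) tvec \<Rightarrow> real"
    and c A :: real
    and lam mu :: "real \<Rightarrow> real"
  assumes "CARD('n) > 1"
    and "smooth_atlas \<A>"
    and "riemannian_metric \<A> g"
    and "constant_curvature \<A> g c"
    and "A > 0"
    and "smooth_on {0<..} lam"
    and "smooth_on {0<..} mu"
    and "\<And>t. t > 0 \<Longrightarrow> lam t > 0"
    and "\<And>t. t > 0 \<Longrightarrow> (2 * c - A\<^sup>2 * t * (lam t)\<^sup>2) / (lam t + 2 * t * deriv lam t) > 0"
    and "\<And>t. t > 0 \<Longrightarrow> lam t + 2 * t * mu t > 0"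
  shows "kaehler \<A> (\<lambda>C. G_loc A c lam mu (metric_comp \<A> g C))
                   (\<lambda>C. J_loc A c lam (metric_comp \<A> g C))
         \<longleftrightarrow> (\<forall>t>0. mu t = deriv lam t)"
proof -
  interpret atlas \<A> by standard (rule assms(2))
  let ?h = "metric_comp \<A> g"
  let ?\<phi> = "fundamental_form (\<lambda>C. G_loc A c lam mu (?h C)) (\<lambda>C. J_loc A c lam (?h C))"
  let ?r = "\<lambda>C. coordinate_metric.raise (?h C)" and ?v = "\<lambda>C. coordinate_metric.vertical_part (?h C)"
  let ?dt = "\<lambda>C z v. ?r C z \<bullet> ?v C z v"
  have dphi: "ext_deriv2 (?\<phi> C) z u v w = (deriv lam (energy (?h C) z) - mu (energy (?h C) z)) *
     (?dt C z u * dp_wedge_dq v w + ?dt C z v * dp_wedge_dq w u + ?dt C z w * dp_wedge_dq u v)"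
    if C: "C \<in> \<A>" and z: "fst z \<in> chart_image C" "snd z \<noteq> 0" for C z u v w
  proof -
    interpret coordinate_metric "?h C" "chart_image C"
      by (rule coordinate_metric[OF assms(3) C])
    show ?thesis
    proof (rule ext_deriv2_fundamental[OF z])
      show "lam differentiable (at (energy (?h C) z))" "mu differentiable (at (energy (?h C) z))"
        using energy_pos[OF z] assms(6,7) by (auto intro: smooth_on_imp_differentiable)
    qed (simp add: fundamental_form_def fundamental_form_eq assms(5,8,9))
  qed
  show ?thesis
  proof
    assume "\<forall>t>0. mu t = deriv lam t"
    moreover have "energy (?h C) z > 0" if "C \<in> \<A>" "fst z \<in> chart_image C" "snd z \<noteq> 0" for C z
      by (rule coordinate_metric.energy_pos[OF coordinate_metric[OF assms(3)]]) (use that in auto)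
    ultimately show "kaehler \<A> (\<lambda>C. G_loc A c lam mu (?h C)) (\<lambda>C. J_loc A c lam (?h C))"
      unfolding kaehler_def closed_form0_def by (simp add: dphi cotangent_coords_nonzero)
  next
    assume K: "kaehler \<A> (\<lambda>C. G_loc A c lam mu (?h C)) (\<lambda>C. J_loc A c lam (?h C))"
    show "\<forall>t>0. mu t = deriv lam t"
    proof (intro allI impI)
      fix t :: real assume t: "t > 0"
      obtain C m where C: "C \<in> \<A>" "m \<in> chart_dom C" using ex_chart by blast
      interpret coordinate_metric "?h C" "chart_image C"
        by (rule coordinate_metric[OF assms(3) C(1)])
      have x: "snd C m \<in> chart_image C" using C by simp
      obtain \<xi> where \<xi>: "\<xi> \<noteq> 0" "energy (?h C) (snd C m, \<xi>) = t"
        by (rule ex_covector_with_energy[OF x t])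
      obtain P where P: "P \<in> cotangent_bundle0 \<A>" "fst P \<in> chart_dom C"
        "cotangent_coords \<A> C P = (snd C m, \<xi>)"
        by (rule cotangent_coords_surj[OF C \<xi>(1)])
      let ?z = "(snd C m, \<xi>)"
      have z: "fst ?z \<in> chart_image C" "snd ?z \<noteq> 0" using x \<xi> by auto
      obtain u v w where nz: "?dt C ?z u * dp_wedge_dq v w + ?dt C ?z v * dp_wedge_dq w u + ?dt C ?z w * dp_wedge_dq u v \<noteq> 0"
        by (rule ext_deriv2_witness[OF assms(1) z])
      have "ext_deriv2 (?\<phi> C) ?z u v w = 0"
        using K P C(1) unfolding kaehler_def closed_form0_def by metis
      with nz show "mu t = deriv lam t"
        unfolding dphi[OF C(1) z] \<xi>(2) by simp
    qed
  qed
qed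

end
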